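(* Let $(Y_i,R_i,X_i)$, $i=1,\dots,n$, be i.i.d. copies of $(Y,R,X)\in\mathbb{R}\times\{0,1\}\times\mathbb{R}^d$ with $Y=X^T\beta_0+\epsilon$, $\mathrm{E}(\epsilon\mid X)=0$, $\mathrm{E}(\epsilon^2\mid X)=\sigma_\epsilon^2$, where $\beta_0\in\mathbb{R}^d$ has support $S_\beta$ with $s_\beta=|S_\beta|$, and with $R$ conditionally independent of $Y$ given $X$. Assume that $X$ is sub-Gaussian in the sense that $\|u^TX\|_{\psi_2}\lesssim(\mathrm{E}[(u^TX)^2])^{1/2}$ for all $u\in\mathbb{R}^d$, and that the restricted eigenvalue condition $$\inf_{v\in\mathcal{C}_1(S_\beta,3)\cap\mathbb{S}^{d-1}}\mathrm{E}[R(X^Tv)^2]\ge\kappa_R^2$$ holds for some $\kappa_R>0$. Let $\hat\beta$ be the complete-case Lasso estimator $$\hat\beta=\arg\min_{\beta\in\mathbb{R}^d}\Big[\frac1n\sum_{i=1}^nR_i(Y_i-X_i^T\beta)^2+\lambda\|\beta\|_1\Big],\qquad\lambda>0.$$ There exist absolute constants $A_1,A_2>0$ such that the following holds. Let $\delta\in(0,1)$ and suppose $n$ is large enough that $$\sqrt{\frac{s_\beta\log(ed/s_\beta)}{n}}+\sqrt{\frac{\log(1/\delta)}{n}}<\min\Big\{\frac{\kappa_R^2}{A_1\phi_{s_\beta}},1\Big\}.$$ (a) If $\lambda>\frac4n\big\|\sum_{i=1}^nR_iX_i\epsilon_i\big\|_\infty>0$ and $d\ge s_\beta+2$, then with probability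 at least $1-\delta$, $\|\hat\beta-\beta_0\|_2\lesssim\frac{\sqrt{s_\beta}\,\lambda}{\kappa_R^2}$. (b) If, in addition, $\|\epsilon\|_{\psi_2}\lesssim\sigma_\epsilon$ and $\lambda=A_2\sigma_\epsilon\sqrt{\frac{\phi_1\log(d/\delta)}{n}}$, then with probability at least $1-\delta$, $$\|\hat\beta-\beta_0\|_2\lesssim\frac{\sigma_\epsilon}{\kappa_R^2}\sqrt{\frac{\phi_1s_\beta\log(d/\delta)}{n}}.$$
   Context: $\epsilon_i=Y_i-X_i^T\beta_0$. The $\psi_\alpha$-Orlicz norm of a random variable $Z$ is $\|Z\|_{\psi_\alpha}=\inf\{t>0:\mathrm{E}\exp(|Z|^\alpha/t^\alpha)\le2\}$. The notation $a\lesssim b$ means $a\le Cb$ for an absolute constant $C>0$. $\mathbb{S}^{d-1}$ is the unit sphere in $\mathbb{R}^d$. For $S\subset\{1,\dots,d\}$, $\vartheta\ge0$, $q\ge1$, the cone is $\mathcal{C}_q(S,\vartheta)=\{v\in\mathbb{R}^d:\|v_{S^c}\|_q\le\vartheta\|v_S\|_q\}$, where $v_S$ is the subvector indexed by $S$. The $s$-sparse maximum eigenvalue is $\phi_s=\sup_{u\in\mathbb{S}^{d-1},\|u\|_0\le s}\mathrm{E}[(X^Tu)^2]$. *)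

theory Defs
  imports "HOL-Probability.Probability"
begin

text \<open>Observation (y, r, x): y real, r the missingness indicator (real, a.s. in {0,1}),
  x in R^d represented as an extensional function on {..<d}.\<close>

definition obs_space :: "nat \<Rightarrow> (real \<times> real \<times> (nat \<Rightarrow> real)) measure" where
  "obs_space d = borel \<Otimes>\<^sub>M (borel \<Otimes>\<^sub>M PiM {..<d} (\<lambda>_. borel))"

definition obsY :: "real \<times> real \<times> (nat \<Rightarrow> real) \<Rightarrow> real" where
  "obsY w = fst w"
definition obsR :: "real \<times> real \<times> (nat \<Rightarrow> real) \<Rightarrow> real" where
  "obsR w = fst (snd w)"
definition obsX :: "real \<times> real \<times> (nat \<Rightarrow> real) \<Rightarrow> (nat \<Rightarrow> real)" where
  "obsX w = snd (snd w)"

definition dinner :: "nat \<Rightarrow> (nat \<Rightarrow> real) \<Rightarrow> (nat \<Rightarrow> real) \<Rightarrow> real" where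
  "dinner d u v = (\<Sum>j<d. u j * v j)"
definition norm1 :: "nat \<Rightarrow> nat set \<Rightarrow> (nat \<Rightarrow> real) \<Rightarrow> real" where
  "norm1 d S v = (\<Sum>j\<in>{..<d} \<inter> S. \<bar>v j\<bar>)"
definition norm2 :: "nat \<Rightarrow> (nat \<Rightarrow> real) \<Rightarrow> real" where
  "norm2 d v = sqrt (\<Sum>j<d. (v j)\<^sup>2)"
definition norminf :: "nat \<Rightarrow> (nat \<Rightarrow> real) \<Rightarrow> real" where
  "norminf d v = Max ((\<lambda>j. \<bar>v j\<bar>) ` {..<d})"
definition supp :: "nat \<Rightarrow> (nat \<Rightarrow> real) \<Rightarrow> nat set" where
  "supp d v = {j. j < d \<and> v j \<noteq> 0}"

definition unit_sphere :: "nat \<Rightarrow> (nat \<Rightarrow> real) set" where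
  "unit_sphere d = {v. norm2 d v = 1}"
definition cone1 :: "nat \<Rightarrow> nat set \<Rightarrow> real \<Rightarrow> (nat \<Rightarrow> real) set" where
  "cone1 d S \<theta> = {v. norm1 d (- S) v \<le> \<theta> * norm1 d S v}"

text \<open>psi_alpha Orlicz norm (value +infinity if no t works).\<close>
definition orlicz_norm :: "real \<Rightarrow> 'a measure \<Rightarrow> ('a \<Rightarrow> real) \<Rightarrow> ereal" where
  "orlicz_norm \<alpha> M Z = Inf {ereal t | t. t > 0 \<and>
      (\<integral>\<^sup>+ w. ennreal (exp (\<bar>Z w\<bar> powr \<alpha> / t powr \<alpha>)) \<partial>M) \<le> 2}"

definition sparse_max_eig :: "(real \<times> real \<times> (nat \<Rightarrow> real)) measure \<Rightarrow> nat \<Rightarrow> nat \<Rightarrow> real" where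
  "sparse_max_eig P d s = Sup ((\<lambda>u. \<integral>w. (dinner d (obsX w) u)\<^sup>2 \<partial>P)
      ` {u. u \<in> unit_sphere d \<and> card (supp d u) \<le> s})"

definition sigmaX :: "nat \<Rightarrow> (real \<times> real \<times> (nat \<Rightarrow> real)) measure \<Rightarrow> (real \<times> real \<times> (nat \<Rightarrow> real)) measure" where
  "sigmaX d P = vimage_algebra (space P) obsX (PiM {..<d} (\<lambda>_. borel))"
definition cond_indep_given :: "'a measure \<Rightarrow> 'a measure \<Rightarrow> ('a \<Rightarrow> real) \<Rightarrow> ('a \<Rightarrow> real) \<Rightarrow> bool" where
  "cond_indep_given M F U V = (\<forall>A \<in> sets (borel :: real measure). \<forall>B \<in> sets (borel :: real measure).
     AE w in M. real_cond_exp M F (\<lambda>w. indicator A (U w) * indicator B (V w)) w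
        = real_cond_exp M F (\<lambda>w. indicator A (U w)) w * real_cond_exp M F (\<lambda>w. indicator B (V w)) w)"

definition noise :: "nat \<Rightarrow> (nat \<Rightarrow> real) \<Rightarrow> real \<times> real \<times> (nat \<Rightarrow> real) \<Rightarrow> real" where
  "noise d \<beta>0 w = obsY w - dinner d (obsX w) \<beta>0"

definition lasso_obj :: "nat \<Rightarrow> nat \<Rightarrow> real \<Rightarrow> (nat \<Rightarrow> real \<times> real \<times> (nat \<Rightarrow> real)) \<Rightarrow> (nat \<Rightarrow> real) \<Rightarrow> real" where
  "lasso_obj d n lam \<omega> \<beta> = (1 / real n) * (\<Sum>i<n. obsR (\<omega> i) * (obsY (\<omega> i) - dinner d (obsX (\<omega> i)) \<beta>)\<^sup>2)
      + lam * norm1 d UNIV \<beta>"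
definition lasso_min :: "nat \<Rightarrow> nat \<Rightarrow> real \<Rightarrow> (nat \<Rightarrow> real \<times> real \<times> (nat \<Rightarrow> real)) \<Rightarrow> (nat \<Rightarrow> real) \<Rightarrow> bool" where
  "lasso_min d n lam \<omega> \<beta> = (\<forall>\<beta>'. lasso_obj d n lam \<omega> \<beta> \<le> lasso_obj d n lam \<omega> \<beta>')"

text \<open>"With probability at least p, Q holds" (inner probability: some event of probability >= p on which Q holds).\<close>
definition whp :: "'a measure \<Rightarrow> real \<Rightarrow> ('a \<Rightarrow> bool) \<Rightarrow> bool" where
  "whp M p Q = (\<exists>E \<in> sets M. measure M E \<ge> p \<and> (\<forall>\<omega>\<in>E. Q \<omega>))"

end

theory Submission
  imports Defs
begin

text \<open>The basic inequality of the Lasso puts the error \<open>\<beta> - \<beta>0\<close> into the cone and bounds its empirical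
  quadratic form by \<open>3/2 \<lambda> \<surd>s\<close> times its norm, so both parts follow once the restricted eigenvalue
  condition passes from the population to the complete cases with \<open>\<kappa>\<^sup>2\<close> replaced by \<open>\<kappa>\<^sup>2/2\<close>.
  The deviation of the empirical from the population form is a bilinear form. On a net of the \<open>s\<close>-sparse
  ball it is controlled by Bernstein's inequality and a union bound (products of sub-Gaussian variables
  are sub-exponential), on the sparse ball by self-bounding, and on the cone by duality, applied to one
  argument at a time.
  In the second part the noise level is controlled by the same Bernstein bound, since
  \<open>R X\<^sub>j \<epsilon>\<close> is centred by the conditional independence of \<open>R\<close> and \<open>Y\<close> given \<open>X\<close>.\<close>

subsection \<open>Nets of the sparse ball\<close>

text \<open>Concentration is available only at the scale of the largest sparse eigenvalue
  \<open>\<phi> s\<close>, while the lower bound on the cone is \<open>\<kappa>\<^sup>2\<close>; the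
  rate hypothesis closes this gap, hence its ratio \<open>\<kappa>\<^sup>2 / \<phi> s\<close>. The
  cone contains vectors of full support, so only sparse vectors are ever put in a net. The passage
  to the cone rests on linearity, which a quadratic form lacks: the deviation is therefore kept
  bilinear, and the net bound is proved for all pairs of net points. The factor 32000 collects 80
  from Bernstein over the pairs, 2 from self-bounding, \<open>(1 + 4)\<^sup>2\<close> from two
  duality steps, 4 from the squared Orlicz scale \<open>4 * K\<^sup>2 * \<phi> s\<close>, and 2
  because the deviation may use up only half of \<open>\<kappa>\<^sup>2\<close>. In part (a) the
  noise condition is a premise on the sample point, so only the design event costs probability; in
  part (b) the design and the noise event take \<open>\<delta> / 2\<close> each.\<close>

text \<open>The full two-sided series is \<open>1 + 2 * t / (1 - t)\<close>, at most
  \<open>1 + 4 * t\<close> for \<open>t\<close> up to 1/2. The extra summand majorises the omitted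
  tail and lets the induction close.\<close>

lemma sum_geometric_int_interval:
  fixes t :: real
  assumes "0 \<le> t" "t \<le> 1/2"
  shows "(\<Sum>k\<in>{-int m..int m}. t ^ nat \<bar>k\<bar>) + 4 * t ^ Suc m \<le> 1 + 4 * t"
proof (induction m)
  case 0
  then show ?case by simp
next
  case (Suc m)
  have eq: "{-int (Suc m)..int (Suc m)} = insert (-int (Suc m)) (insert (int (Suc m)) {-int m..int m})"
    by auto
  have "(\<Sum>k\<in>{-int (Suc m)..int (Suc m)}. t ^ nat \<bar>k\<bar>)
      = 2 * t ^ Suc m + (\<Sum>k\<in>{-int m..int m}. t ^ nat \<bar>k\<bar>)"
    unfolding eq by (simp add: nat_add_distrib)
  moreover have "4 * t ^ Suc (Suc m) \<le> 2 * t ^ Suc m"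
    using mult_right_mono[of "2 * t" 1 "2 * t ^ Suc m"] assms by simp
  ultimately show ?case using Suc.IH by linarith
qed

text \<open>A Chernoff-type count: with weight \<open>t\<close> to the power of its 1-norm, every
  counted vector weighs at least \<open>t ^ m\<close>, while the total weight factorises over the
  coordinates into \<open>d\<close> factors of at most \<open>1 + 4 * t\<close>.\<close>

lemma card_int_vectors_le:
  fixes t :: real and d m :: nat
  assumes t: "0 < t" "t \<le> 1/2"
  defines "Z \<equiv> {z \<in> {..<d} \<rightarrow>\<^sub>E (UNIV :: int set). (\<Sum>j<d. \<bar>z j\<bar>) \<le> int m}"
  shows "finite Z" and "real (card Z) \<le> (1 / t) ^ m * exp (4 * t * real d)"
proof -
  let ?I = "{-int m..int m}" and ?w = "\<lambda>k :: int. t ^ nat \<bar>k\<bar>"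
  have sub: "Z \<subseteq> {..<d} \<rightarrow>\<^sub>E ?I"
  proof
    fix z assume z: "z \<in> Z"
    have "\<bar>z j\<bar> \<le> int m" if "j < d" for j
      using member_le_sum[of j "{..<d}" "\<lambda>j. \<bar>z j\<bar>"] that z by (auto simp: Z_def)
    then have "z j \<in> ?I" if "j < d" for j
      using that by (auto simp: abs_le_iff minus_le_iff)
    then show "z \<in> {..<d} \<rightarrow>\<^sub>E ?I"
      using z by (auto simp: Z_def PiE_iff)
  qed
  have fin: "finite ({..<d} \<rightarrow>\<^sub>E ?I)" by (intro finite_PiE) auto
  show "finite Z" using finite_subset[OF sub fin] .
  have "real (card Z) * t ^ m = (\<Sum>z\<in>Z. t ^ m)" by simp
  also have "\<dots> \<le> (\<Sum>z\<in>Z. \<Prod>j<d. ?w (z j))"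
  proof (rule sum_mono)
    fix z assume z: "z \<in> Z"
    have "int (\<Sum>j<d. nat \<bar>z j\<bar>) = (\<Sum>j<d. \<bar>z j\<bar>)" by simp
    also have "\<dots> \<le> int m" using z by (simp add: Z_def)
    finally have "(\<Sum>j<d. nat \<bar>z j\<bar>) \<le> m" by (simp only: of_nat_le_iff)
    then show "t ^ m \<le> (\<Prod>j<d. ?w (z j))"
      using t by (simp add: power_sum[symmetric] power_decreasing)
  qed
  also have "\<dots> \<le> (\<Sum>z\<in>{..<d} \<rightarrow>\<^sub>E ?I. \<Prod>j<d. ?w (z j))"
    using t by (intro sum_mono2[OF fin sub] prod_nonneg) auto
  also have "\<dots> = (\<Prod>j<d. \<Sum>k\<in>?I. ?w k)"
    by (rule prod_sum_PiE[symmetric]) auto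
  also have "\<dots> \<le> (\<Prod>j<d. exp (4 * t))"
  proof (intro prod_mono conjI sum_nonneg)
    have "(\<Sum>k\<in>?I. ?w k) \<le> 1 + 4 * t"
      using sum_geometric_int_interval[of t m] t zero_le_power[of t "Suc m"] by linarith
    then show "(\<Sum>k\<in>?I. ?w k) \<le> exp (4 * t)"
      using exp_ge_add_one_self[of "4 * t"] by linarith
  qed (use t in auto)
  also have "\<dots> = exp (4 * t * real d)" by (simp add: exp_of_nat_mult[symmetric] mult.commute)
  finally show "real (card Z) \<le> (1 / t) ^ m * exp (4 * t * real d)"
    using t by (simp add: field_simps)
qed

lemma norm2_nonneg [simp]: "0 \<le> norm2 d v"
  by (simp add: norm2_def sum_nonneg)

lemma norm2_power2: "(norm2 d v)\<^sup>2 = (\<Sum>j<d. (v j)\<^sup>2)"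
  by (simp add: norm2_def sum_nonneg)

lemma norm2_scale: "norm2 d (\<lambda>j. c * v j) = \<bar>c\<bar> * norm2 d v"
  by (simp add: norm2_def power_mult_distrib sum_distrib_left[symmetric] real_sqrt_mult)

lemma norm2_le_iff: "0 \<le> r \<Longrightarrow> norm2 d v \<le> r \<longleftrightarrow> (\<Sum>j<d. (v j)\<^sup>2) \<le> r\<^sup>2"
  by (simp add: norm2_power2[symmetric] power2_le_iff_abs_le)

lemma abs_le_norm2:
  assumes "j < d"
  shows "\<bar>v j\<bar> \<le> norm2 d v"
proof -
  have "(v j)\<^sup>2 \<le> (norm2 d v)\<^sup>2"
    unfolding norm2_power2 using assms by (intro member_le_sum) auto
  then show ?thesis by (simp add: abs_le_square_iff[symmetric])
qed

text \<open>A ball rather than a sphere, so that rescaled rounding errors, whose norm is only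
  bounded from above, belong to it again.\<close>

definition sparse_ball :: "nat \<Rightarrow> nat \<Rightarrow> (nat \<Rightarrow> real) set" where
  "sparse_ball d s = {a. norm2 d a \<le> 1 \<and> card (supp d a) \<le> s}"

lemma finite_supp [simp]: "finite (supp d v)"
  by (simp add: supp_def)

lemma round_towards_zero:
  fixes x :: real
  obtains k :: int where "\<bar>of_int k\<bar> \<le> \<bar>x\<bar>" "\<bar>x - of_int k\<bar> \<le> 1"
proof (cases "0 \<le> x")
  case True
  then have "0 \<le> \<lfloor>x\<rfloor>" by simp
  then show ?thesis using True by (intro that[of "\<lfloor>x\<rfloor>"]) (simp_all, linarith+)
next
  case False
  then have "\<lceil>x\<rceil> \<le> 0" by simp
  then show ?thesis using False by (intro that[of "\<lceil>x\<rceil>"]) (simp_all, linarith+)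
qed

text \<open>The net consists of the sparse vectors with coordinates in \<open>\<int> / (4 \<surd>s)\<close>, counted by the
  generating function of the integer vectors with weight \<open>t = s / (2 d)\<close>; rounding towards zero keeps
  both the support and the norm bound.\<close>

lemma sparse_ball_net:
  assumes s: "1 \<le> s" "s \<le> d"
  obtains N where "finite N" "N \<subseteq> sparse_ball d s"
    "real (card N) \<le> exp (18 * (real s * ln (exp 1 * real d / real s)))"
    "\<And>a. a \<in> sparse_ball d s \<Longrightarrow>
       \<exists>b\<in>N. supp d b \<subseteq> supp d a \<and> norm2 d (\<lambda>j. a j - b j) \<le> 1 / 4"
proof -
  \<comment> \<open>The radius fits the rounding of \<open>q * a\<close>: an integer is at most its
    square in absolute value, so the absolute values add up to at most \<open>q\<^sup>2\<close>
    times the squared norm of \<open>a\<close>, that is \<open>16 * s\<close>.\<close>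
  define Z where "Z = {z \<in> {..<d} \<rightarrow>\<^sub>E (UNIV :: int set). (\<Sum>j<d. \<bar>z j\<bar>) \<le> int (16 * s)}"
  \<comment> \<open>At most \<open>s\<close> coordinates, each off by at most \<open>1 / q\<close>,
    give a Euclidean error of at most \<open>sqrt s / q\<close>, which is 1/4.\<close>
  define q where "q = 4 * sqrt (real s)"
  define F where "F = (\<lambda>(z :: nat \<Rightarrow> int) j. real_of_int (z j) / q)"
  define N where "N = F ` Z \<inter> sparse_ball d s"
  \<comment> \<open>Then \<open>1 / t\<close> is \<open>2 * d / s\<close>, at most
    \<open>exp 1 * d / s\<close>, and \<open>4 * t * d\<close> is \<open>2 * s\<close>. The exponent
    18 is 16 from the power of \<open>1 / t\<close> plus 2 from the exponential factor, the
    logarithm being at least 1.\<close>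
  define t where "t = real s / (2 * real d)"
  have t: "0 < t" "t \<le> 1/2" using s by (auto simp: t_def field_simps)
  have q: "q > 0" "q\<^sup>2 = 16 * real s" using s by (auto simp: q_def power_mult_distrib)
  note Z = card_int_vectors_le[OF t, of d "16 * s", folded Z_def]
  have "real (card N) \<le> real (card Z)"
    unfolding N_def using Z(1) by (meson Int_lower1 card_image_le card_mono finite_imageI le_trans of_nat_mono)
  also have "\<dots> \<le> (1 / t) ^ (16 * s) * exp (4 * t * real d)" by (rule Z(2))
  also have "\<dots> \<le> exp (18 * (real s * ln (exp 1 * real d / real s)))"
  proof -
    let ?l = "ln (exp 1 * real d / real s)"
    have l: "1 \<le> ?l" using s by (simp add: ln_div ln_mult)
    have "2 \<le> exp (1 :: real)" using exp_ge_add_one_self[of 1] by simp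
    then have "1 / t \<le> exp ?l" using s by (simp add: t_def divide_right_mono mult_right_mono)
    then have "(1 / t) ^ (16 * s) \<le> exp ?l ^ (16 * s)" using t by (intro power_mono) auto
    also have "\<dots> = exp (16 * (real s * ?l))"
      by (simp only: exp_of_nat_mult[symmetric] of_nat_mult of_nat_numeral mult.assoc)
    finally have "(1 / t) ^ (16 * s) * exp (4 * t * real d) \<le> exp (16 * (real s * ?l)) * exp (4 * t * real d)"
      by (intro mult_right_mono) auto
    also have "\<dots> \<le> exp (16 * (real s * ?l)) * exp (2 * (real s * ?l))"
      using s l by (auto simp: t_def)
    also have "\<dots> = exp (18 * (real s * ?l))" by (simp add: exp_add[symmetric])
    finally show ?thesis .
  qed
  finally have card: "real (card N) \<le> exp (18 * (real s * ln (exp 1 * real d / real s)))" .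
  have "\<exists>b\<in>N. supp d b \<subseteq> supp d a \<and> norm2 d (\<lambda>j. a j - b j) \<le> 1 / 4"
    if a: "a \<in> sparse_ball d s" for a
  proof -
    have "\<exists>k. \<bar>of_int k\<bar> \<le> \<bar>q * a j\<bar> \<and> \<bar>q * a j - of_int k\<bar> \<le> 1" for j
      using round_towards_zero[of "q * a j"] by metis
    then obtain k where k: "\<And>j. \<bar>of_int (k j)\<bar> \<le> \<bar>q * a j\<bar>" "\<And>j. \<bar>q * a j - of_int (k j)\<bar> \<le> 1"
      by metis
    define z where "z = restrict k {..<d}"
    have z: "z j = k j" if "j < d" for j using that by (simp add: z_def)
    have na: "(\<Sum>j<d. (a j)\<^sup>2) \<le> 1" and ca: "card (supp d a) \<le> s"
      using a by (auto simp: sparse_ball_def norm2_le_iff)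
    have sq: "(real_of_int (z j))\<^sup>2 \<le> q\<^sup>2 * (a j)\<^sup>2" if "j < d" for j
      using k(1)[of j] z[OF that] by (simp add: abs_le_square_iff power_mult_distrib)
    have "\<bar>real_of_int (z j)\<bar> \<le> (real_of_int (z j))\<^sup>2" for j
    proof -
      have "\<bar>z j\<bar> * 1 \<le> \<bar>z j\<bar> * \<bar>z j\<bar>"
        by (cases "z j = 0") (auto intro!: mult_left_mono simp del: abs_mult_self_eq)
      then have "\<bar>z j\<bar> \<le> (z j)\<^sup>2" by (simp add: power2_eq_square)
      then show ?thesis by (metis of_int_abs of_int_le_iff of_int_power)
    qed
    then have "real_of_int (\<Sum>j<d. \<bar>z j\<bar>) \<le> (\<Sum>j<d. q\<^sup>2 * (a j)\<^sup>2)"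
      using sq by (auto intro!: sum_mono intro: order_trans)
    also have "\<dots> \<le> 16 * real s"
      using na q mult_left_mono[OF na, of "16 * real s"] by (simp add: sum_distrib_left[symmetric])
    finally have "real_of_int (\<Sum>j<d. \<bar>z j\<bar>) \<le> real_of_int (int (16 * s))" by simp
    then have zZ: "z \<in> Z" unfolding Z_def of_int_le_iff by (simp add: z_def)
    have supp: "supp d (F z) \<subseteq> supp d a"
    proof
      fix j assume "j \<in> supp d (F z)"
      then show "j \<in> supp d a" using k(1)[of j] q by (auto simp: supp_def F_def z)
    qed
    have "(\<Sum>j<d. (F z j)\<^sup>2) \<le> (\<Sum>j<d. (a j)\<^sup>2)"
      using sq s unfolding q(2) by (intro sum_mono) (auto simp: F_def power_divide q(2) field_simps)
    moreover have "card (supp d (F z)) \<le> s"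
      using card_mono[OF _ supp] ca by simp
    ultimately have "F z \<in> N"
      using na zZ by (auto simp: N_def sparse_ball_def norm2_le_iff)
    moreover have "norm2 d (\<lambda>j. a j - F z j) \<le> 1 / 4"
    proof -
      have "(\<Sum>j<d. (a j - F z j)\<^sup>2) = (\<Sum>j\<in>supp d a. (a j - F z j)\<^sup>2)"
        using supp by (intro sum.mono_neutral_right) (auto simp: supp_def)
      also have "\<dots> \<le> (\<Sum>j\<in>supp d a. 1 / q\<^sup>2)"
      proof (rule sum_mono)
        fix j assume "j \<in> supp d a"
        then have j: "j < d" by (simp add: supp_def)
        have "a j - F z j = (q * a j - of_int (k j)) / q"
          using q by (simp add: F_def z[OF j] field_simps)
        moreover have "(q * a j - of_int (k j))\<^sup>2 \<le> 1"
          using k(2)[of j] by (simp add: abs_square_le_1)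
        ultimately show "(a j - F z j)\<^sup>2 \<le> 1 / q\<^sup>2"
          by (simp add: power_divide divide_right_mono)
      qed
      also have "\<dots> \<le> (1 / 4)\<^sup>2"
        using ca s q by (simp add: field_simps power2_eq_square)
      finally show ?thesis by (subst norm2_le_iff) simp_all
    qed
    ultimately show ?thesis using supp by blast
  qed
  then show ?thesis
    using that[of N] Z(1) card by (auto simp: N_def)
qed

section \<open>Bilinear forms: from a net to the sparse ball and on to the cone\<close>

lemma dinner_le_norm2: "\<bar>dinner d u v\<bar> \<le> norm2 d u * norm2 d v"
proof -
  have "\<bar>dinner d u v\<bar> \<le> (\<Sum>j<d. \<bar>u j\<bar> * \<bar>v j\<bar>)"
    unfolding dinner_def by (intro order_trans[OF sum_abs]) (simp add: abs_mult)
  also have "\<dots> \<le> norm2 d u * norm2 d v"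
    using L2_set_mult_ineq[of u v "{..<d}"] by (simp add: norm2_def L2_set_def)
  finally show ?thesis .
qed

text \<open>In the application \<open>A\<close> is the difference of the empirical and the
  population second-moment matrix of the complete cases.\<close>

definition bilin :: "nat \<Rightarrow> (nat \<Rightarrow> nat \<Rightarrow> real) \<Rightarrow> (nat \<Rightarrow> real) \<Rightarrow> (nat \<Rightarrow> real) \<Rightarrow> real" where
  "bilin d A a b = (\<Sum>i<d. \<Sum>j<d. a i * A i j * b j)"

lemma bilin_dinner: "bilin d A a b = dinner d a (\<lambda>i. dinner d (A i) b)"
  by (simp add: bilin_def dinner_def sum_distrib_left mult.assoc)

lemma bilin_dinner': "bilin d A a b = dinner d b (\<lambda>j. \<Sum>i<d. a i * A i j)"
  unfolding bilin_def by (subst sum.swap) (simp add: dinner_def sum_distrib_left mult_ac)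

lemma bilin_scale: "bilin d A (\<lambda>j. c * a j) b = c * bilin d A a b"
    "bilin d A a (\<lambda>j. c * b j) = c * bilin d A a b"
  by (simp_all add: bilin_def sum_distrib_left mult_ac)

lemma bilin_diff: "bilin d A (\<lambda>j. a j - a' j) b = bilin d A a b - bilin d A a' b"
    "bilin d A a (\<lambda>j. b j - b' j) = bilin d A a b - bilin d A a b'"
  by (simp_all add: bilin_def sum_subtractf algebra_simps)

lemma zero_sparse_ball: "(\<lambda>_. 0) \<in> sparse_ball d s"
  by (simp add: sparse_ball_def norm2_def supp_def)

text \<open>Replacing one argument by its net point changes the form by at most a quarter of its
  supremum \<open>M\<close>, because four times the rounding error lies in the sparse ball again.
  Two replacements give \<open>M \<le> \<tau> + M / 2\<close>.\<close>

lemma abs_bilin_le_net: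
  assumes net: "\<And>a. a \<in> sparse_ball d s \<Longrightarrow>
       \<exists>b\<in>N. supp d b \<subseteq> supp d a \<and> norm2 d (\<lambda>j. a j - b j) \<le> 1 / 4"
    and N: "N \<subseteq> sparse_ball d s"
    and \<tau>: "\<And>a b. a \<in> N \<Longrightarrow> b \<in> N \<Longrightarrow> \<bar>bilin d A a b\<bar> \<le> \<tau>"
    and ab: "a \<in> sparse_ball d s" "b \<in> sparse_ball d s"
  shows "\<bar>bilin d A a b\<bar> \<le> 2 * \<tau>"
proof -
  define M where "M = (SUP p \<in> sparse_ball d s \<times> sparse_ball d s. \<bar>bilin d A (fst p) (snd p)\<bar>)"
  \<comment> \<open>Absorbing \<open>M / 2\<close> requires \<open>M\<close> to be a genuine real
    supremum; a crude entrywise bound is enough for that.\<close>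
  have bdd: "bdd_above ((\<lambda>p. \<bar>bilin d A (fst p) (snd p)\<bar>) ` (sparse_ball d s \<times> sparse_ball d s))"
  proof (intro bdd_aboveI2[where M = "\<Sum>i<d. \<Sum>j<d. \<bar>A i j\<bar>"])
    fix p assume "p \<in> sparse_ball d s \<times> sparse_ball d s"
    then have le: "\<bar>fst p j\<bar> \<le> 1" "\<bar>snd p j\<bar> \<le> 1" if "j < d" for j
      using abs_le_norm2[OF that] by (fastforce simp: sparse_ball_def intro: order_trans)+
    have "\<bar>fst p i * A i j * snd p j\<bar> \<le> \<bar>A i j\<bar>" if "i < d" "j < d" for i j
      using mult_mono[OF mult_right_mono[OF le(1)[OF that(1)], of "\<bar>A i j\<bar>"] le(2)[OF that(2)]]
      by (simp add: abs_mult)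
    then show "\<bar>bilin d A (fst p) (snd p)\<bar> \<le> (\<Sum>i<d. \<Sum>j<d. \<bar>A i j\<bar>)"
      unfolding bilin_def by (intro order_trans[OF sum_abs] sum_mono) auto
  qed
  have M: "\<bar>bilin d A u v\<bar> \<le> M" if "u \<in> sparse_ball d s" "v \<in> sparse_ball d s" for u v
    unfolding M_def using cSUP_upper[OF _ bdd, of "(u, v)"] that by simp
  \<comment> \<open>Support inclusion keeps the difference \<open>s\<close>-sparse; with an
    unrelated net point it could have up to \<open>2 * s\<close> nonzero coordinates.\<close>
  have scale: "(\<lambda>j. 4 * (u j - u' j)) \<in> sparse_ball d s"
    if "supp d u' \<subseteq> supp d u" "norm2 d (\<lambda>j. u j - u' j) \<le> 1 / 4" "u \<in> sparse_ball d s" for u u'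
  proof -
    have "supp d (\<lambda>j. 4 * (u j - u' j)) \<subseteq> supp d u" using that(1) by (auto simp: supp_def)
    from card_mono[OF finite_supp this] have "card (supp d (\<lambda>j. 4 * (u j - u' j))) \<le> s"
      using that(3) by (simp add: sparse_ball_def)
    then show ?thesis using that(2) by (simp add: sparse_ball_def norm2_scale del: right_diff_distrib_numeral)
  qed
  have step: "\<bar>bilin d A u v\<bar> \<le> \<tau> + M / 2" if uv: "u \<in> sparse_ball d s" "v \<in> sparse_ball d s" for u v
  proof -
    obtain u' where u': "u' \<in> N" "supp d u' \<subseteq> supp d u" "norm2 d (\<lambda>j. u j - u' j) \<le> 1 / 4"
      using net[OF uv(1)] by blast
    obtain v' where v': "v' \<in> N" "supp d v' \<subseteq> supp d v" "norm2 d (\<lambda>j. v j - v' j) \<le> 1 / 4"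
      using net[OF uv(2)] by blast
    have "\<bar>4 * (bilin d A u v - bilin d A u' v)\<bar> \<le> M"
      using M[OF scale[OF u'(2,3) uv(1)] uv(2)] by (simp add: bilin_scale bilin_diff)
    moreover have "\<bar>4 * (bilin d A u' v - bilin d A u' v')\<bar> \<le> M"
      using M[OF _ scale[OF v'(2,3) uv(2)], of u'] u'(1) N by (auto simp: bilin_scale bilin_diff)
    ultimately show ?thesis using \<tau>[OF u'(1) v'(1)] unfolding abs_le_iff by auto
  qed
  have "M \<le> \<tau> + M / 2"
    unfolding M_def
    by (rule cSUP_least) (use zero_sparse_ball[of d s] step in \<open>auto simp: M_def[symmetric]\<close>)
  then show ?thesis using M[OF ab] by linarith
qed

lemma exists_largest_coordinates:
  fixes w :: "nat \<Rightarrow> real"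
  assumes "s \<le> d"
  obtains T where "T \<subseteq> {..<d}" "card T = s" "\<And>i j. i \<in> T \<Longrightarrow> j \<in> {..<d} - T \<Longrightarrow> \<bar>w j\<bar> \<le> \<bar>w i\<bar>"
proof -
  have "\<exists>T \<subseteq> {..<d}. card T = s \<and> (\<forall>i\<in>T. \<forall>j\<in>{..<d} - T. \<bar>w j\<bar> \<le> \<bar>w i\<bar>)"
    using assms
  proof (induction s)
    case (Suc s)
    then obtain T where T: "T \<subseteq> {..<d}" "card T = s" "\<forall>i\<in>T. \<forall>j\<in>{..<d} - T. \<bar>w j\<bar> \<le> \<bar>w i\<bar>"
      by auto
    have finT: "finite T" using T(1) finite_subset by blast
    have ne: "{..<d} - T \<noteq> {}"
      using card_mono[OF finT, of "{..<d}"] T(2) Suc.prems by auto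
    let ?A = "(\<lambda>j. \<bar>w j\<bar>) ` ({..<d} - T)"
    have "Max ?A \<in> ?A" using ne by (intro Max_in) auto
    then obtain k where "k \<in> {..<d} - T" "Max ?A = \<bar>w k\<bar>" by blast
    moreover have "\<bar>w j\<bar> \<le> Max ?A" if "j \<in> {..<d} - T" for j
      using that by (intro Max_ge) auto
    ultimately have k: "k \<in> {..<d} - T" "\<forall>j\<in>{..<d} - T. \<bar>w j\<bar> \<le> \<bar>w k\<bar>" by auto
    show ?case
      using T k finT by (intro exI[of _ "insert k T"]) auto
  qed auto
  then show ?thesis using that by blast
qed

text \<open>This replaces the covering of the cone by a multiple of the convex hull of sparse vectors:
  by duality only the \<open>s\<close> largest coordinates of \<open>w\<close> matter.\<close>

lemma dinner_le_sparse:
  assumes s: "1 \<le> s" "s \<le> d"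
    and M: "\<And>a. a \<in> sparse_ball d s \<Longrightarrow> dinner d a w \<le> M"
    and v: "norm2 d v \<le> 1" "norm1 d UNIV v \<le> c * sqrt (real s)"
  shows "dinner d v w \<le> (1 + c) * M"
proof -
  have M0: "0 \<le> M" using M[OF zero_sparse_ball] by (simp add: dinner_def)
  obtain T where T: "T \<subseteq> {..<d}" "card T = s" "\<And>i j. i \<in> T \<Longrightarrow> j \<in> {..<d} - T \<Longrightarrow> \<bar>w j\<bar> \<le> \<bar>w i\<bar>"
    using exists_largest_coordinates[OF s(2)] by blast
  have finT: "finite T" using T(1) finite_subset by blast
  define W where "W = L2_set w T"
  have W2: "(\<Sum>i\<in>T. (w i)\<^sup>2) = W\<^sup>2" by (simp add: W_def L2_set_def sum_nonneg)
  have restr: "(\<Sum>j<d. if j \<in> T then f j else 0) = (\<Sum>j\<in>T. f j)" for f :: "nat \<Rightarrow> real"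
    using T(1) by (simp add: sum.If_cases Int_absorb1)
  \<comment> \<open>The test vector is \<open>w\<close> restricted to \<open>T\<close> and
    normalised: it is \<open>s\<close>-sparse of norm one, and its inner product with
    \<open>w\<close> is \<open>W\<close>.\<close>
  have WM: "W \<le> M"
  proof (cases "W = 0")
    case False
    then have W: "0 < W" by (simp add: W_def less_le)
    define a where "a = (\<lambda>j. if j \<in> T then w j / W else 0)"
    have "(\<Sum>j<d. (a j)\<^sup>2) = (\<Sum>j<d. if j \<in> T then (w j)\<^sup>2 / W\<^sup>2 else 0)"
      by (intro sum.cong) (auto simp: a_def power_divide)
    also have "\<dots> = 1" using W by (simp add: restr sum_divide_distrib[symmetric] W2)
    finally have "norm2 d a \<le> 1" by (simp add: norm2_le_iff)
    moreover have "card (supp d a) \<le> s"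
      unfolding T(2)[symmetric] by (intro card_mono finT) (auto simp: supp_def a_def split: if_splits)
    ultimately have "dinner d a w \<le> M" by (intro M) (simp add: sparse_ball_def)
    moreover have "dinner d a w = (\<Sum>j<d. if j \<in> T then (w j)\<^sup>2 / W else 0)"
      unfolding dinner_def by (intro sum.cong) (auto simp: a_def power2_eq_square)
    ultimately have "W\<^sup>2 / W \<le> M" by (simp add: restr sum_divide_distrib[symmetric] W2)
    then show ?thesis by (simp add: power2_eq_square)
  qed (use M0 in simp)
  \<comment> \<open>A coordinate outside \<open>T\<close> is dominated by each of the
    \<open>s\<close> coordinates inside, hence by their root mean square \<open>W / sqrt s\<close>.
    The factor \<open>sqrt s\<close> in the 1-norm bound on \<open>v\<close> cancels this
    denominator.\<close>
  have tail: "\<bar>w j\<bar> \<le> M / sqrt (real s)" if j: "j \<in> {..<d} - T" for j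
  proof -
    have "real s * (w j)\<^sup>2 = (\<Sum>i\<in>T. (w j)\<^sup>2)" using T(2) by simp
    also have "\<dots> \<le> (\<Sum>i\<in>T. (w i)\<^sup>2)"
      using T(3)[OF _ j] by (intro sum_mono) (simp add: abs_le_square_iff)
    also have "\<dots> \<le> M\<^sup>2" unfolding W2 using WM by (simp add: W_def power_mono)
    finally have "(sqrt (real s) * \<bar>w j\<bar>)\<^sup>2 \<le> M\<^sup>2" by (simp add: power_mult_distrib)
    then have "sqrt (real s) * \<bar>w j\<bar> \<le> M" using M0 by (rule power2_le_imp_le)
    then show ?thesis using s by (simp add: field_simps)
  qed
  have "L2_set v T \<le> norm2 d v"
    unfolding L2_set_def norm2_def using T(1) by (intro real_sqrt_le_mono sum_mono2) auto
  then have "(\<Sum>j\<in>T. \<bar>v j\<bar> * \<bar>w j\<bar>) \<le> 1 * M"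
    using L2_set_mult_ineq[of v w T] v(1) WM M0 mult_mono[of "L2_set v T" 1 W M]
    by (simp add: W_def)
  moreover have "(\<Sum>j\<in>{..<d} - T. \<bar>v j\<bar> * \<bar>w j\<bar>) \<le> c * M"
  proof -
    have "(\<Sum>j\<in>{..<d} - T. \<bar>v j\<bar> * \<bar>w j\<bar>) \<le> (\<Sum>j\<in>{..<d} - T. \<bar>v j\<bar> * (M / sqrt (real s)))"
      using tail by (intro sum_mono mult_left_mono) auto
    also have "\<dots> \<le> (\<Sum>j<d. \<bar>v j\<bar> * (M / sqrt (real s)))"
      using M0 by (intro sum_mono2) auto
    also have "\<dots> = norm1 d UNIV v * (M / sqrt (real s))"
      by (simp add: norm1_def sum_distrib_right sum_divide_distrib)
    also have "\<dots> \<le> c * sqrt (real s) * (M / sqrt (real s))"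
      using v(2) M0 by (intro mult_right_mono) auto
    finally show ?thesis using s by simp
  qed
  moreover have "dinner d v w \<le> (\<Sum>j<d. \<bar>v j\<bar> * \<bar>w j\<bar>)"
    unfolding dinner_def by (intro sum_mono) (simp add: abs_mult[symmetric])
  moreover have "(\<Sum>j<d. \<bar>v j\<bar> * \<bar>w j\<bar>) = (\<Sum>j\<in>T. \<bar>v j\<bar> * \<bar>w j\<bar>) + (\<Sum>j\<in>{..<d} - T. \<bar>v j\<bar> * \<bar>w j\<bar>)"
    using T(1) by (simp add: sum.subset_diff add.commute)
  ultimately show ?thesis by (simp add: algebra_simps)
qed

text \<open>With the first argument sparse and fixed, duality extends the second one; the bound so
  obtained is uniform in the first, which a second application extends. Each costs a factor
  \<open>1 + c\<close>. Duality is one-sided, so the absolute value comes from \<open>A\<close>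
  together with its negative.\<close>

lemma bilin_le_sparse:
  assumes s: "1 \<le> s" "s \<le> d"
    and M: "\<And>a b. a \<in> sparse_ball d s \<Longrightarrow> b \<in> sparse_ball d s \<Longrightarrow> \<bar>bilin d A a b\<bar> \<le> M"
    and v: "norm2 d v \<le> 1" "norm1 d UNIV v \<le> c * sqrt (real s)"
  shows "\<bar>bilin d A v v\<bar> \<le> (1 + c)\<^sup>2 * M"
proof -
  have bd: "bilin d A' v v \<le> (1 + c)\<^sup>2 * M"
    if M': "\<And>a b. a \<in> sparse_ball d s \<Longrightarrow> b \<in> sparse_ball d s \<Longrightarrow> bilin d A' a b \<le> M" for A'
  proof -
    have "bilin d A' a v \<le> (1 + c) * M" if a: "a \<in> sparse_ball d s" for a
      unfolding bilin_dinner'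
      by (rule dinner_le_sparse[OF s _ v]) (use M'[OF a] in \<open>simp add: bilin_dinner'\<close>)
    then have "bilin d A' v v \<le> (1 + c) * ((1 + c) * M)"
      unfolding bilin_dinner by (intro dinner_le_sparse[OF s _ v])
    then show ?thesis by (simp add: power2_eq_square mult.assoc)
  qed
  have "bilin d (\<lambda>i j. - A i j) a b = - bilin d A a b" for a b
    by (simp add: bilin_def sum_negf)
  then show ?thesis
    using bd[of A] bd[of "\<lambda>i j. - A i j"] M by (fastforce simp: abs_le_iff)
qed

section \<open>The cone and the deterministic inequality of the Lasso\<close>

lemma norm1_split: "norm1 d UNIV v = norm1 d S v + norm1 d (- S) v"
proof -
  have "{..<d} = {..<d} \<inter> S \<union> {..<d} \<inter> - S" by auto
  then show ?thesis
    unfolding norm1_def by (subst sum.union_disjoint[symmetric]) auto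
qed

lemma norm1_le_sqrt_card:
  assumes "S \<subseteq> {..<d}"
  shows "norm1 d S v \<le> sqrt (real (card S)) * norm2 d v"
proof -
  have "norm1 d S v = (\<Sum>j\<in>S. \<bar>1::real\<bar> * \<bar>v j\<bar>)"
    using assms by (simp add: norm1_def Int_absorb1)
  also have "\<dots> \<le> L2_set (\<lambda>_. 1) S * L2_set v S" by (rule L2_set_mult_ineq)
  also have "\<dots> = sqrt (real (card S)) * L2_set v S" by (simp add: L2_set_def)
  also have "\<dots> \<le> sqrt (real (card S)) * norm2 d v"
    unfolding L2_set_def norm2_def using assms by (intro mult_left_mono real_sqrt_le_mono sum_mono2) auto
  finally show ?thesis .
qed

lemma cone1_norm1_le:
  assumes "v \<in> cone1 d S 3" "S \<subseteq> {..<d}"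
  shows "norm1 d UNIV v \<le> 4 * sqrt (real (card S)) * norm2 d v"
  using assms norm1_le_sqrt_card[OF assms(2), of v] norm1_split[of d v S] by (simp add: cone1_def)

text \<open>Comparing the objective at \<open>\<beta>\<close> and \<open>\<beta>0\<close>, the
  quadratic form of \<open>h\<close> is bounded by a term linear in the noise plus a difference of
  penalties. The former is at most half the penalty of \<open>h\<close>, and the latter gains off
  \<open>S\<close>, where \<open>\<beta>0\<close> vanishes.\<close>

lemma lasso_basic:
  assumes min: "lasso_min d n lam \<omega> \<beta>"
    and d: "0 < d" and lam: "0 < lam"
    and R: "\<And>i. i < n \<Longrightarrow> 0 \<le> obsR (\<omega> i)"
    and noise: "4 / real n * norminf d (\<lambda>j. \<Sum>i<n. obsR (\<omega> i) * obsX (\<omega> i) j * noise d \<beta>0 (\<omega> i)) \<le> lam"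
  defines "h \<equiv> \<lambda>j. \<beta> j - \<beta>0 j"
  defines "S \<equiv> supp d \<beta>0"
  shows "h \<in> cone1 d S 3"
    and "(1 / real n) * (\<Sum>i<n. obsR (\<omega> i) * (dinner d (obsX (\<omega> i)) h)\<^sup>2)
      \<le> 3 / 2 * lam * norm1 d S h"
proof -
  define e where "e = (\<lambda>i. noise d \<beta>0 (\<omega> i))"
  define R' where "R' = (\<lambda>i. obsR (\<omega> i))"
  define g where "g = (\<lambda>j. \<Sum>i<n. R' i * obsX (\<omega> i) j * e i)"
  define X where "X = (\<lambda>i. dinner d (obsX (\<omega> i)) h)"
  have y0: "obsY (\<omega> i) - dinner d (obsX (\<omega> i)) \<beta>0 = e i" for i
    by (simp add: e_def noise_def)
  have y1: "obsY (\<omega> i) - dinner d (obsX (\<omega> i)) \<beta> = e i - X i" for i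
    unfolding y0[symmetric] by (simp add: X_def h_def dinner_def right_diff_distrib sum_subtractf)
  have "lasso_obj d n lam \<omega> \<beta> \<le> lasso_obj d n lam \<omega> \<beta>0" using min by (simp add: lasso_min_def)
  then have "1 / real n * (\<Sum>i<n. R' i * (e i - X i)\<^sup>2) + lam * norm1 d UNIV \<beta>
      \<le> 1 / real n * (\<Sum>i<n. R' i * (e i)\<^sup>2) + lam * norm1 d UNIV \<beta>0"
    unfolding lasso_obj_def y0 y1 R'_def .
  moreover have "(\<Sum>i<n. R' i * (e i - X i)\<^sup>2)
      = (\<Sum>i<n. R' i * (e i)\<^sup>2) - 2 * (\<Sum>i<n. R' i * e i * X i) + (\<Sum>i<n. R' i * (X i)\<^sup>2)"
    by (simp add: power2_diff algebra_simps sum.distrib sum_subtractf sum_distrib_left)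
  moreover have "(\<Sum>i<n. R' i * e i * X i) = dinner d g h"
    unfolding X_def dinner_def g_def sum_distrib_left sum_distrib_right
    by (subst sum.swap) (simp add: mult_ac)
  ultimately have 1: "1 / real n * (\<Sum>i<n. R' i * (X i)\<^sup>2)
      \<le> 2 / real n * dinner d g h + lam * (norm1 d UNIV \<beta>0 - norm1 d UNIV \<beta>)"
    by (simp add: algebra_simps)
  have "dinner d g h \<le> (\<Sum>j<d. norminf d g * \<bar>h j\<bar>)"
    unfolding dinner_def
  proof (rule sum_mono)
    fix j assume "j \<in> {..<d}"
    then have "\<bar>g j\<bar> \<le> norminf d g" unfolding norminf_def by (intro Max_ge) auto
    then show "g j * h j \<le> norminf d g * \<bar>h j\<bar>"
      using mult_right_mono[of "\<bar>g j\<bar>" "norminf d g" "\<bar>h j\<bar>"] abs_ge_self[of "g j * h j"]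
      by (simp add: abs_mult)
  qed
  also have "\<dots> = norminf d g * norm1 d UNIV h"
    by (simp add: norm1_def sum_distrib_left)
  finally have "2 / real n * dinner d g h \<le> 2 / real n * (norminf d g * norm1 d UNIV h)"
    by (intro mult_left_mono) auto
  \<comment> \<open>The factor 4 in the noise condition leaves \<open>lam / 2\<close> here, so half
    of the penalty off \<open>S\<close> survives and the cone gets opening 3.\<close>
  also have "\<dots> = (4 / real n * norminf d g) / 2 * norm1 d UNIV h" by simp
  also have "\<dots> \<le> lam / 2 * norm1 d UNIV h"
    using noise by (intro mult_right_mono)
      (auto simp: g_def R'_def e_def norm1_def sum_nonneg divide_right_mono)
  finally have 2: "2 / real n * dinner d g h \<le> lam / 2 * (norm1 d S h + norm1 d (- S) h)"
    by (simp add: norm1_split[of d h S])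
  have "norm1 d S \<beta>0 \<le> norm1 d S \<beta> + norm1 d S h"
    unfolding norm1_def sum.distrib[symmetric] by (intro sum_mono) (simp add: h_def)
  moreover have "norm1 d (- S) \<beta>0 = 0" "norm1 d (- S) \<beta> = norm1 d (- S) h"
    unfolding norm1_def S_def supp_def h_def by (auto intro!: sum.neutral sum.cong)
  ultimately have 3: "lam * (norm1 d UNIV \<beta>0 - norm1 d UNIV \<beta>) \<le> lam * (norm1 d S h - norm1 d (- S) h)"
    using lam by (intro mult_left_mono) (auto simp: norm1_split[of d _ S])
  \<comment> \<open>Both claims are read off from this: a nonnegative left side gives the cone, and
    dropping the negative term gives the bound.\<close>
  have 4: "1 / real n * (\<Sum>i<n. R' i * (X i)\<^sup>2) \<le> lam / 2 * (3 * norm1 d S h - norm1 d (- S) h)"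
    using 1 2 3 by (simp add: algebra_simps)
  have "0 \<le> norm1 d (- S) h" by (simp add: norm1_def sum_nonneg)
  then have "lam / 2 * (3 * norm1 d S h - norm1 d (- S) h) \<le> lam / 2 * (3 * norm1 d S h)"
    using lam by (intro mult_left_mono) auto
  then show "(1 / real n) * (\<Sum>i<n. obsR (\<omega> i) * (dinner d (obsX (\<omega> i)) h)\<^sup>2)
      \<le> 3 / 2 * lam * norm1 d S h"
    using 4 by (simp add: R'_def X_def)
  have "0 \<le> 1 / real n * (\<Sum>i<n. R' i * (X i)\<^sup>2)"
    using R by (intro mult_nonneg_nonneg sum_nonneg) (auto simp: R'_def)
  then have "0 \<le> lam / 2 * (3 * norm1 d S h - norm1 d (- S) h)" using 4 by linarith
  then show "h \<in> cone1 d S 3" using lam by (simp add: cone1_def zero_le_mult_iff)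
qed

subsection \<open>Concentration\<close>

lemma power2_le_exp_half:
  fixes u :: real
  assumes "0 \<le> u"
  shows "u\<^sup>2 \<le> 8 * exp (u / 2)"
  using exp_lower_Taylor_quadratic[of "u / 2"] assms by (simp add: power2_eq_square)

lemma exp_le_quadratic:
  fixes x :: real
  shows "exp x \<le> 1 + x + x\<^sup>2 / 2 * exp \<bar>x\<bar>"
proof -
  obtain t where t: "\<bar>t\<bar> \<le> \<bar>x\<bar>" "exp x = (\<Sum>m<2. x ^ m / fact m) + exp t / fact 2 * x ^ 2"
    using Maclaurin_exp_le[of x 2] by blast
  have "exp t \<le> exp \<bar>x\<bar>" using t(1) by simp
  then have "exp t * x\<^sup>2 \<le> exp \<bar>x\<bar> * x\<^sup>2" by (intro mult_right_mono) auto
  then show ?thesis using t(2) by (simp add: numeral_2_eq_2 field_simps)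
qed

text \<open>Pointwise, \<^term>\<open>exp (\<theta> * x)\<close> is at most
  \<^term>\<open>1 + \<theta> * x + 4 * \<theta>\<^sup>2 * L\<^sup>2 * exp (\<bar>x\<bar> / L)\<close>, since one half of the
  exponential moment absorbs the square.\<close>

lemma mgf_bound:
  fixes f :: "'a \<Rightarrow> real"
  assumes "prob_space M"
    and f [measurable]: "f \<in> borel_measurable M"
    and L: "0 < L" and E: "(\<integral>\<^sup>+x. ennreal (exp (\<bar>f x\<bar> / L)) \<partial>M) \<le> 2"
    and \<theta>: "\<bar>\<theta>\<bar> \<le> 1 / (2 * L)"
  shows "(\<integral>\<^sup>+x. ennreal (exp (\<theta> * (f x - (\<integral>x. f x \<partial>M)))) \<partial>M) \<le> ennreal (exp (8 * \<theta>\<^sup>2 * L\<^sup>2))"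
proof -
  interpret prob_space M by fact
  let ?g = "\<lambda>x. exp (\<bar>f x\<bar> / L)" and ?m = "\<integral>x. f x \<partial>M"
  have g: "integrable M ?g"
    using E by (intro integrableI_bounded) (auto simp: less_top[symmetric] top_unique intro: order.strict_trans1)
  have g2: "(\<integral>x. ?g x \<partial>M) \<le> 2"
    using E unfolding nn_integral_eq_integral[OF g, simplified]
    by (metis ennreal_le_iff ennreal_numeral zero_le_numeral)
  have f_int: "integrable M f"
  proof (rule Bochner_Integration.integrable_bound[OF integrable_mult_right[OF g, of L]])
    show "AE x in M. norm (f x) \<le> norm (L * ?g x)"
    proof (intro AE_I2)
      fix x
      have "\<bar>f x\<bar> / L \<le> ?g x" using exp_ge_add_one_self[of "\<bar>f x\<bar> / L"] by linarith
      then show "norm (f x) \<le> norm (L * ?g x)" using L by (simp add: field_simps)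
    qed
  qed simp
  have pt: "exp (\<theta> * f x) \<le> 1 + \<theta> * f x + 4 * \<theta>\<^sup>2 * L\<^sup>2 * ?g x" for x
  proof -
    let ?u = "\<bar>f x\<bar> / L"
    have "\<bar>\<theta> * f x\<bar> \<le> ?u / 2"
      using mult_right_mono[OF \<theta>, of "\<bar>f x\<bar>"] by (simp add: abs_mult mult.commute)
    then have "(\<theta> * f x)\<^sup>2 / 2 * exp \<bar>\<theta> * f x\<bar> \<le> (\<theta> * f x)\<^sup>2 / 2 * exp (?u / 2)"
      by (intro mult_left_mono) auto
    also have "\<dots> = \<theta>\<^sup>2 * L\<^sup>2 / 2 * exp (?u / 2) * ?u\<^sup>2"
      using L by (simp add: power_mult_distrib power_divide)
    also have "\<dots> \<le> \<theta>\<^sup>2 * L\<^sup>2 / 2 * exp (?u / 2) * (8 * exp (?u / 2))"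
      using power2_le_exp_half[of ?u] L by (intro mult_left_mono) auto
    also have "\<dots> = 4 * \<theta>\<^sup>2 * L\<^sup>2 * (exp (?u / 2) * exp (?u / 2))" by simp
    also have "exp (?u / 2) * exp (?u / 2) = ?g x" by (simp add: exp_add[symmetric])
    finally show ?thesis using exp_le_quadratic[of "\<theta> * f x"] by linarith
  qed
  have int: "integrable M (\<lambda>x. 1 + \<theta> * f x + 4 * \<theta>\<^sup>2 * L\<^sup>2 * ?g x)"
    using f_int g by simp
  have int_exp: "integrable M (\<lambda>x. exp (\<theta> * f x))"
  proof (rule Bochner_Integration.integrable_bound[OF int])
    show "AE x in M. norm (exp (\<theta> * f x)) \<le> norm (1 + \<theta> * f x + 4 * \<theta>\<^sup>2 * L\<^sup>2 * ?g x)"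
      using pt by (intro AE_I2) (smt (verit) exp_gt_zero real_norm_def)
  qed simp
  have "(\<integral>x. exp (\<theta> * f x) \<partial>M) \<le> (\<integral>x. 1 + \<theta> * f x + 4 * \<theta>\<^sup>2 * L\<^sup>2 * ?g x \<partial>M)"
    using pt by (intro integral_mono int int_exp)
  also have "\<dots> = 1 + \<theta> * ?m + 4 * \<theta>\<^sup>2 * L\<^sup>2 * (\<integral>x. ?g x \<partial>M)"
    using f_int g by (simp add: prob_space)
  also have "\<dots> \<le> 1 + \<theta> * ?m + 4 * \<theta>\<^sup>2 * L\<^sup>2 * 2"
    using g2 by (intro add_left_mono mult_left_mono) auto
  also have "\<dots> \<le> exp (\<theta> * ?m + 8 * \<theta>\<^sup>2 * L\<^sup>2)"
    using exp_ge_add_one_self[of "\<theta> * ?m + 8 * \<theta>\<^sup>2 * L\<^sup>2"] by linarith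
  finally have *: "(\<integral>x. exp (\<theta> * f x) \<partial>M) \<le> exp (\<theta> * ?m + 8 * \<theta>\<^sup>2 * L\<^sup>2)" .
  have "(\<integral>\<^sup>+x. ennreal (exp (\<theta> * (f x - ?m))) \<partial>M)
      = (\<integral>\<^sup>+x. ennreal (exp (- \<theta> * ?m) * exp (\<theta> * f x)) \<partial>M)"
    by (simp add: exp_add[symmetric] algebra_simps)
  also have "\<dots> = ennreal (exp (- \<theta> * ?m) * (\<integral>x. exp (\<theta> * f x) \<partial>M))"
    using int_exp by (subst nn_integral_eq_integral) auto
  also have "\<dots> \<le> ennreal (exp (- \<theta> * ?m) * exp (\<theta> * ?m + 8 * \<theta>\<^sup>2 * L\<^sup>2))"
    using * by (intro ennreal_leI mult_left_mono) auto
  also have "exp (- \<theta> * ?m) * exp (\<theta> * ?m + 8 * \<theta>\<^sup>2 * L\<^sup>2) = exp (8 * \<theta>\<^sup>2 * L\<^sup>2)"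
    by (simp add: exp_add[symmetric])
  finally show "(\<integral>\<^sup>+x. ennreal (exp (\<theta> * (f x - ?m))) \<partial>M) \<le> ennreal (exp (8 * \<theta>\<^sup>2 * L\<^sup>2))" .
qed

lemma borel_measurable_PiM_coordinate:
  fixes g :: "'a \<Rightarrow> real" and n :: nat
  assumes "g \<in> borel_measurable P" "i < n"
  shows "(\<lambda>\<omega>. g (\<omega> i)) \<in> borel_measurable (PiM {..<n} (\<lambda>_. P))"
  using assms by (intro measurable_compose[OF measurable_component_singleton]) auto

text \<open>Markov's inequality for the exponential of the sum, whose nonnegative integral
  factorises under the product measure. The multiplier is part of \<open>g\<close>, so both tails
  are instances.\<close>

lemma chernoff_iid:
  fixes g :: "'a \<Rightarrow> real" and n :: nat
  assumes "prob_space P" and g [measurable]: "g \<in> borel_measurable P"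
    and c: "(\<integral>\<^sup>+x. ennreal (exp (g x)) \<partial>P) \<le> ennreal (exp c)"
  defines "Q \<equiv> PiM {..<n} (\<lambda>_. P)"
  shows "measure Q {\<omega> \<in> space Q. (\<Sum>i<n. g (\<omega> i)) \<ge> t} \<le> exp (real n * c - t)"
proof -
  interpret P: prob_space P by fact
  interpret product_sigma_finite "\<lambda>_::nat. P" ..
  have [measurable]: "(\<lambda>\<omega>. g (\<omega> i)) \<in> borel_measurable Q" if "i < n" for i
    using that unfolding Q_def by (rule borel_measurable_PiM_coordinate[OF g])
  have nn: "(\<integral>\<^sup>+\<omega>. ennreal (exp (\<Sum>i<n. g (\<omega> i))) \<partial>Q) \<le> ennreal (exp (real n * c))"
  proof -
    have "(\<integral>\<^sup>+\<omega>. ennreal (exp (\<Sum>i<n. g (\<omega> i))) \<partial>Q) = (\<integral>\<^sup>+\<omega>. (\<Prod>i<n. ennreal (exp (g (\<omega> i)))) \<partial>Q)"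
      by (simp add: exp_sum prod_ennreal)
    also have "\<dots> = (\<Prod>i<n. \<integral>\<^sup>+x. ennreal (exp (g x)) \<partial>P)"
      unfolding Q_def by (rule product_nn_integral_prod) auto
    also have "\<dots> \<le> (\<Prod>i<n. ennreal (exp c))"
      using c by (simp add: power_mono)
    also have "\<dots> = ennreal (exp (real n * c))"
      by (simp add: ennreal_power exp_of_nat_mult)
    finally show ?thesis .
  qed
  have "emeasure Q {\<omega> \<in> space Q. (\<Sum>i<n. g (\<omega> i)) \<ge> t}
      = (\<integral>\<^sup>+\<omega>. indicator {\<omega> \<in> space Q. (\<Sum>i<n. g (\<omega> i)) \<ge> t} \<omega> \<partial>Q)"
    by (subst nn_integral_indicator) auto
  also have "\<dots> \<le> (\<integral>\<^sup>+\<omega>. ennreal (exp (- t)) * ennreal (exp (\<Sum>i<n. g (\<omega> i))) \<partial>Q)"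
    by (intro nn_integral_mono)
       (auto simp: indicator_def ennreal_mult[symmetric] exp_add[symmetric] simp flip: ennreal_1
         intro!: ennreal_leI)
  also have "\<dots> = ennreal (exp (- t)) * (\<integral>\<^sup>+\<omega>. ennreal (exp (\<Sum>i<n. g (\<omega> i))) \<partial>Q)"
    by (rule nn_integral_cmult) auto
  also have "\<dots> \<le> ennreal (exp (- t)) * ennreal (exp (real n * c))"
    using nn by (intro mult_left_mono) auto
  also have "\<dots> = ennreal (exp (real n * c - t))"
    by (simp add: ennreal_mult[symmetric] exp_add[symmetric])
  finally show ?thesis
    unfolding measure_def by (intro enn2real_leI) auto
qed

text \<open>For \<open>r\<close> at most 1 the optimal multiplier stays, up to constants, in the
  range where the exponential moment is quadratic, so the threshold is linear in \<open>r\<close>.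
  The free parameter \<open>b\<close> is there to pay for union bounds.\<close>

lemma bernstein_iid:
  fixes f :: "'a \<Rightarrow> real" and n :: nat
  assumes P: "prob_space P" and f [measurable]: "f \<in> borel_measurable P"
    and L: "0 < L" and E: "(\<integral>\<^sup>+x. ennreal (exp (\<bar>f x\<bar> / L)) \<partial>P) \<le> 2"
    and r: "0 \<le> r" "r \<le> 1" and n: "0 < n"
  defines "Q \<equiv> PiM {..<n} (\<lambda>_. P)"
  shows "measure Q {\<omega> \<in> space Q. \<bar>1 / real n * (\<Sum>i<n. f (\<omega> i)) - (\<integral>x. f x \<partial>P)\<bar> \<ge> 2 * (b + 2) * L * r}
    \<le> 2 * exp (- b * (real n * r\<^sup>2))"
proof -
  let ?m = "\<integral>x. f x \<partial>P"
  interpret Q: prob_space Q unfolding Q_def by (rule prob_space_PiM) (rule P)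
  have [measurable]: "(\<lambda>\<omega>. f (\<omega> i)) \<in> borel_measurable Q" if "i < n" for i
    using that unfolding Q_def by (rule borel_measurable_PiM_coordinate[OF f])
  \<comment> \<open>The moment bound then contributes \<open>2 * real n * r\<^sup>2\<close> to the
    exponent, which accounts for the 2 in \<open>b + 2\<close>; the outer factor 2 in the threshold
    undoes the 2 in \<open>\<theta>\<close>.\<close>
  define \<theta> where "\<theta> = r / (2 * L)"
  have \<theta>0: "0 \<le> \<theta>" and \<theta>: "\<bar>\<theta>\<bar> \<le> 1 / (2 * L)" "\<bar>- \<theta>\<bar> \<le> 1 / (2 * L)"
    using r L by (auto simp: \<theta>_def divide_right_mono)
  have sq: "\<theta>\<^sup>2 * L\<^sup>2 = r\<^sup>2 / 4" "\<theta> * L = r / 2" using L by (auto simp: \<theta>_def field_simps power2_eq_square)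
  define t where "t = real n * (b + 2) * r\<^sup>2"
  define A where "A = (\<lambda>\<tau>. {\<omega> \<in> space Q. (\<Sum>i<n. \<tau> * (f (\<omega> i) - ?m)) \<ge> t})"
  have meas: "A \<tau> \<in> sets Q" for \<tau> unfolding A_def by measurable
  have bound: "measure Q (A \<tau>) \<le> exp (- b * (real n * r\<^sup>2))" if "\<tau> = \<theta> \<or> \<tau> = - \<theta>" for \<tau>
  proof -
    have \<tau>: "\<bar>\<tau>\<bar> \<le> 1 / (2 * L)" "\<tau>\<^sup>2 = \<theta>\<^sup>2" using that \<theta> by auto
    have "measure Q (A \<tau>) \<le> exp (real n * (8 * \<tau>\<^sup>2 * L\<^sup>2) - t)"
      unfolding A_def Q_def by (rule chernoff_iid[OF P _ mgf_bound[OF P f L E \<tau>(1)]]) auto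
    also have "real n * (8 * \<tau>\<^sup>2 * L\<^sup>2) - t = - b * (real n * r\<^sup>2)"
      using sq(1) \<tau>(2) by (simp add: t_def algebra_simps)
    finally show ?thesis .
  qed
  have "{\<omega> \<in> space Q. \<bar>1 / real n * (\<Sum>i<n. f (\<omega> i)) - ?m\<bar> \<ge> 2 * (b + 2) * L * r} \<subseteq> A \<theta> \<union> A (- \<theta>)"
  proof
    fix \<omega> assume \<omega>: "\<omega> \<in> {\<omega> \<in> space Q. \<bar>1 / real n * (\<Sum>i<n. f (\<omega> i)) - ?m\<bar> \<ge> 2 * (b + 2) * L * r}"
    let ?x = "1 / real n * (\<Sum>i<n. f (\<omega> i)) - ?m"
    have "real n * \<theta> * (2 * (b + 2) * L * r) \<le> real n * \<theta> * \<bar>?x\<bar>"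
      using \<omega> \<theta>0 by (intro mult_left_mono) auto
    moreover have "real n * \<theta> * (2 * (b + 2) * L * r) = t"
    proof -
      have "real n * \<theta> * (2 * (b + 2) * L * r) = real n * (2 * (b + 2) * r) * (\<theta> * L)"
        by (simp only: mult_ac)
      then show ?thesis unfolding sq(2) by (simp add: t_def power2_eq_square field_simps)
    qed
    ultimately have t: "t \<le> real n * \<theta> * \<bar>?x\<bar>" by simp
    have sum: "(\<Sum>i<n. \<tau> * (f (\<omega> i) - ?m)) = real n * \<tau> * ?x" for \<tau>
      using n by (simp add: sum_distrib_left[symmetric] sum_subtractf field_simps)
    have "t \<le> real n * \<theta> * ?x \<or> t \<le> real n * (- \<theta>) * ?x"
    proof -
      have "c * \<bar>x\<bar> = c * x \<or> c * \<bar>x\<bar> = - c * x" for c x :: real by (auto simp: abs_if)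
      from this[of "real n * \<theta>" ?x] show ?thesis using t by auto
    qed
    then show "\<omega> \<in> A \<theta> \<union> A (- \<theta>)"
      using \<omega> unfolding A_def Un_iff mem_Collect_eq sum by blast
  qed
  then have "measure Q {\<omega> \<in> space Q. \<bar>1 / real n * (\<Sum>i<n. f (\<omega> i)) - ?m\<bar> \<ge> 2 * (b + 2) * L * r}
      \<le> measure Q (A \<theta> \<union> A (- \<theta>))"
    using meas by (intro Q.finite_measure_mono) auto
  also have "\<dots> \<le> measure Q (A \<theta>) + measure Q (A (- \<theta>))"
    using meas by (intro measure_Un_le) auto
  also have "\<dots> \<le> 2 * exp (- b * (real n * r\<^sup>2))" using bound[of \<theta>] bound[of "- \<theta>"] by auto
  finally show ?thesis .
qed

text \<open>The good event is the complement of finitely many bad ones, so finiteness of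
  \<open>I\<close> yields both the union bound and the measurability that \<open>whp\<close> asks
  for.\<close>

lemma bernstein_iid_finite:
  fixes F :: "'b \<Rightarrow> 'a \<Rightarrow> real" and n :: nat
  assumes P: "prob_space P" and I: "finite I" and F [measurable]: "\<And>k. k \<in> I \<Longrightarrow> F k \<in> borel_measurable P"
    and L: "0 < L" and E: "\<And>k. k \<in> I \<Longrightarrow> (\<integral>\<^sup>+x. ennreal (exp (\<bar>F k x\<bar> / L)) \<partial>P) \<le> 2"
    and r: "0 \<le> r" "r \<le> 1" and n: "0 < n"
    and card: "2 * real (card I) * exp (- b * (real n * r\<^sup>2)) \<le> p"
  defines "Q \<equiv> PiM {..<n} (\<lambda>_. P)"
  shows "whp Q (1 - p) (\<lambda>\<omega>. \<forall>k\<in>I.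
    \<bar>1 / real n * (\<Sum>i<n. F k (\<omega> i)) - (\<integral>x. F k x \<partial>P)\<bar> < 2 * (b + 2) * L * r)"
proof -
  interpret Q: prob_space Q unfolding Q_def by (rule prob_space_PiM) (rule P)
  define A where "A = (\<lambda>k. {\<omega> \<in> space Q. \<bar>1 / real n * (\<Sum>i<n. F k (\<omega> i)) - (\<integral>x. F k x \<partial>P)\<bar> \<ge> 2 * (b + 2) * L * r})"
  have A: "A k \<in> sets Q" if "k \<in> I" for k
  proof -
    have [measurable]: "(\<lambda>\<omega>. F k (\<omega> i)) \<in> borel_measurable Q" if "i < n" for i
      using that unfolding Q_def by (rule borel_measurable_PiM_coordinate[OF F[OF \<open>k \<in> I\<close>]])
    show ?thesis unfolding A_def by measurable
  qed
  have "measure Q (\<Union>k\<in>I. A k) \<le> (\<Sum>k\<in>I. measure Q (A k))"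
    using A I by (intro Q.finite_measure_subadditive_finite) auto
  also have "\<dots> \<le> (\<Sum>k\<in>I. 2 * exp (- b * (real n * r\<^sup>2)))"
    unfolding A_def Q_def by (intro sum_mono bernstein_iid P F L E r n)
  also have "\<dots> \<le> p" using card by (simp add: mult_ac)
  finally have "1 - p \<le> measure Q (space Q - (\<Union>k\<in>I. A k))"
    using A I by (subst Q.prob_compl) auto
  moreover have "space Q - (\<Union>k\<in>I. A k) \<in> sets Q" using A I by auto
  ultimately show ?thesis
    unfolding whp_def by (rule_tac bexI[of _ "space Q - (\<Union>k\<in>I. A k)"]) (auto simp: A_def not_le)
qed

lemma whp_conj:
  assumes "prob_space M" "whp M (1 - p) A" "whp M (1 - q) B"
  shows "whp M (1 - (p + q)) (\<lambda>\<omega>. A \<omega> \<and> B \<omega>)"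
proof -
  interpret prob_space M by fact
  obtain E F where E: "E \<in> sets M" "1 - p \<le> prob E" "\<And>\<omega>. \<omega> \<in> E \<Longrightarrow> A \<omega>"
    and F: "F \<in> sets M" "1 - q \<le> prob F" "\<And>\<omega>. \<omega> \<in> F \<Longrightarrow> B \<omega>"
    using assms(2,3) by (auto simp: whp_def)
  have "prob E + prob F - prob (E \<union> F) = prob (E \<inter> F)"
    using measure_Un3[of E M F] E(1) F(1) by (simp add: fmeasurable_eq_sets)
  then have "1 - (p + q) \<le> prob (E \<inter> F)" using E(2) F(2) prob_le_1[of "E \<union> F"] by linarith
  then show ?thesis unfolding whp_def using E F by (intro bexI[of _ "E \<inter> F"]) auto
qed

lemma whp_mono:
  assumes "whp M p A" "p' \<le> p" "\<And>\<omega>. A \<omega> \<Longrightarrow> B \<omega>"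
  shows "whp M p' B"
  using assms unfolding whp_def by (meson order_trans)

subsection \<open>Conditional independence and Orlicz norms\<close>

text \<open>Weighting \<open>M\<close> by the indicator of \<open>U = 1\<close> or by its conditional expectation gives two finite
  measures that agree on the rectangles generating \<open>\<sigma>(V, X)\<close>.\<close>

lemma cond_indep_integral:
  fixes U V :: "'a \<Rightarrow> real" and X :: "'a \<Rightarrow> 'b" and g :: "real \<times> 'b \<Rightarrow> real"
  assumes "prob_space M"
    and X [measurable]: "X \<in> measurable M N" and U [measurable]: "U \<in> borel_measurable M"
    and V [measurable]: "V \<in> borel_measurable M"
  defines "F \<equiv> vimage_algebra (space M) X N"
  assumes ci: "cond_indep_given M F U V"
    and g [measurable]: "g \<in> borel_measurable (borel \<Otimes>\<^sub>M N)"
  shows "(\<integral>w. indicator {1} (U w) * g (V w, X w) \<partial>M)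
      = (\<integral>w. real_cond_exp M F (\<lambda>w. indicator {1} (U w)) w * g (V w, X w) \<partial>M)"
proof -
  interpret prob_space M by fact
  have sub: "subalgebra M F"
    unfolding subalgebra_def F_def using sets_image_in_sets[OF refl X] by simp
  interpret finite_measure_subalgebra M F by standard (rule sub)
  have XF [measurable]: "X \<in> measurable F N"
    unfolding F_def using measurable_space[OF X] by (intro measurable_vimage_algebra1) auto
  let ?u = "\<lambda>w. indicator {1} (U w) :: real"
  define p where "p = real_cond_exp M F ?u"
  have pF [measurable]: "p \<in> borel_measurable F" by (simp add: p_def)
  have pM [measurable]: "p \<in> borel_measurable M" by (simp add: p_def)
  have p0: "AE w in M. 0 \<le> p w"
    unfolding p_def by (rule real_cond_exp_pos) auto
  have u_int: "integrable M ?u" by (rule integrable_const_bound[of _ 1]) auto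
  have p_int: "integrable M p" unfolding p_def using u_int by (rule real_cond_exp_int)
  \<comment> \<open>Here conditional independence enters: the indicator of \<open>X\<close> is
    pulled through the conditional expectation, the conditional expectation of the product splits,
    and that of \<open>V\<close> is undone because \<open>p\<close> is measurable with respect to
    \<open>F\<close>.\<close>
  have rect: "(\<integral>w. ?u w * (indicator B (V w) * indicator A (X w)) \<partial>M)
      = (\<integral>w. p w * (indicator B (V w) * indicator A (X w)) \<partial>M)"
    if [measurable]: "B \<in> sets borel" "A \<in> sets N" for A B
  proof -
    let ?v = "\<lambda>w. indicator B (V w) :: real" and ?x = "\<lambda>w. indicator A (X w) :: real"
    have xF [measurable]: "?x \<in> borel_measurable F" by measurable
    have "(\<integral>w. ?u w * (?v w * ?x w) \<partial>M) = (\<integral>w. ?x w * (?u w * ?v w) \<partial>M)"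
      by (simp add: mult_ac)
    also have "\<dots> = (\<integral>w. ?x w * real_cond_exp M F (\<lambda>w. ?u w * ?v w) w \<partial>M)"
      by (rule real_cond_exp_intg(2)[symmetric])
         (auto intro!: integrable_const_bound[of _ 1] simp: indicator_def)
    also have "\<dots> = (\<integral>w. (?x w * p w) * real_cond_exp M F ?v w \<partial>M)"
    proof (rule integral_cong_AE)
      show "AE w in M. ?x w * real_cond_exp M F (\<lambda>w. ?u w * ?v w) w = ?x w * p w * real_cond_exp M F ?v w"
        using ci that(1) unfolding cond_indep_given_def p_def
        by (elim ballE[of _ _ "{1}"] ballE[of _ _ B]) (auto elim!: eventually_mono)
    qed (auto intro: borel_measurable_cond_exp2)
    also have "\<dots> = (\<integral>w. (?x w * p w) * ?v w \<partial>M)"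
    proof (rule real_cond_exp_intg(2))
      show "integrable M (\<lambda>w. ?x w * p w * ?v w)"
        by (rule Bochner_Integration.integrable_bound[OF p_int]) (auto simp: indicator_def)
    qed auto
    also have "\<dots> = (\<integral>w. p w * (?v w * ?x w) \<partial>M)" by (simp add: mult_ac)
    finally show ?thesis .
  qed
  have VX [measurable]: "(\<lambda>w. (V w, X w)) \<in> measurable M (borel \<Otimes>\<^sub>M N)" by measurable
  define D where "D = (\<lambda>f. distr (density M (\<lambda>w. ennreal (f w))) (borel \<Otimes>\<^sub>M N) (\<lambda>w. (V w, X w)))"
  have em: "emeasure (D f) (B \<times> A) = ennreal (\<integral>w. f w * (indicator B (V w) * indicator A (X w)) \<partial>M)"
    if f: "integrable M f" "AE w in M. 0 \<le> f w" and [measurable]: "B \<in> sets borel" "A \<in> sets N"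
    for f :: "'a \<Rightarrow> real" and A B
  proof -
    have [measurable]: "f \<in> borel_measurable M" using f(1) by simp
    have BA: "B \<times> A \<in> sets (borel \<Otimes>\<^sub>M N)" by measurable
    have "emeasure (D f) (B \<times> A) = emeasure (density M (\<lambda>w. ennreal (f w))) ((\<lambda>w. (V w, X w)) -` (B \<times> A) \<inter> space M)"
      unfolding D_def using BA by (subst emeasure_distr) auto
    also have "\<dots> = (\<integral>\<^sup>+w. ennreal (f w) * indicator ((\<lambda>w. (V w, X w)) -` (B \<times> A) \<inter> space M) w \<partial>M)"
      using measurable_sets[OF VX BA] by (intro emeasure_density) auto
    also have "\<dots> = (\<integral>\<^sup>+w. ennreal (f w * (indicator B (V w) * indicator A (X w))) \<partial>M)"
      by (intro nn_integral_cong) (auto simp: indicator_def)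
    also have "\<dots> = ennreal (\<integral>w. f w * (indicator B (V w) * indicator A (X w)) \<partial>M)"
    proof (rule nn_integral_eq_integral)
      show "integrable M (\<lambda>w. f w * (indicator B (V w) * indicator A (X w)))"
        by (rule Bochner_Integration.integrable_bound[OF f(1)]) (auto simp: indicator_def)
      show "AE w in M. 0 \<le> f w * (indicator B (V w) * indicator A (X w))"
        using f(2) by (auto elim!: eventually_mono)
    qed
    finally show ?thesis .
  qed
  have u0: "AE w in M. 0 \<le> ?u w" by simp
  have "D ?u = D p"
  proof (rule measure_eqI_generator_eq[OF Int_stable_pair_measure_generator[of borel N] pair_measure_closed])
    fix C :: "(real \<times> 'b) set" assume "C \<in> {a \<times> b | a b. a \<in> sets borel \<and> b \<in> sets N}"
    then show "emeasure (D ?u) C = emeasure (D p) C"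
      using em[OF u_int u0] em[OF p_int p0] rect by auto
  next
    show "range (\<lambda>_. space borel \<times> space N) \<subseteq> {a \<times> b | a b. a \<in> sets borel \<and> b \<in> sets N}"
      using sets.top[of borel] sets.top[of N] by blast
    show "emeasure (D ?u) (space borel \<times> space N) \<noteq> \<infinity>" for i :: nat
      using em[OF u_int u0, of "space borel" "space N"] by simp
  qed (auto simp: D_def sets_pair_measure)
  \<comment> \<open>Equal laws have equal Bochner integrals, whether or not \<open>g\<close> is
    integrable.\<close>
  then have "(\<integral>z. g z \<partial>D ?u) = (\<integral>z. g z \<partial>D p)" by simp
  moreover have "(\<integral>z. g z \<partial>D f) = (\<integral>w. f w * g (V w, X w) \<partial>M)"
    if [measurable]: "f \<in> borel_measurable M" and "AE w in M. 0 \<le> f w" for f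
    unfolding D_def by (subst integral_distr, simp, simp, subst integral_density) (use that in auto)
  ultimately show ?thesis using p0 u0 by (simp add: p_def[symmetric])
qed

text \<open>Replacing \<open>U\<close> by its conditional expectation \<open>p\<close> leaves
  \<open>p * h\<close> measurable with respect to \<open>F\<close>, so conditioning turns
  \<open>e\<close> into zero. Conditional independence concerns the response \<open>V\<close> and
  not the noise, hence the detour through a function \<open>g\<close> of \<open>V\<close> and
  \<open>X\<close> that represents \<open>h * e\<close>.\<close>

lemma cond_indep_integral_zero:
  fixes U V e h :: "'a \<Rightarrow> real" and X :: "'a \<Rightarrow> 'b" and g :: "real \<times> 'b \<Rightarrow> real"
  assumes M: "prob_space M"
    and X [measurable]: "X \<in> measurable M N" and U [measurable]: "U \<in> borel_measurable M"
    and V [measurable]: "V \<in> borel_measurable M"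
  defines "F \<equiv> vimage_algebra (space M) X N"
  assumes ci: "cond_indep_given M F U V" and U01: "AE w in M. U w \<in> {0, 1}"
    and g: "g \<in> borel_measurable (borel \<Otimes>\<^sub>M N)"
    and h [measurable]: "h \<in> borel_measurable F" and e [measurable]: "e \<in> borel_measurable M"
    and ghe: "\<And>w. w \<in> space M \<Longrightarrow> g (V w, X w) = h w * e w"
    and int: "integrable M (\<lambda>w. h w * e w)"
    and e0: "AE w in M. real_cond_exp M F e w = 0"
  shows "(\<integral>w. U w * (h w * e w) \<partial>M) = 0"
proof -
  interpret prob_space M by fact
  have sub: "subalgebra M F"
    unfolding subalgebra_def F_def using sets_image_in_sets[OF refl X] by simp
  interpret finite_measure_subalgebra M F by standard (rule sub)
  let ?u = "\<lambda>w. indicator {1} (U w) :: real"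
  define p where "p = real_cond_exp M F ?u"
  have pF [measurable]: "p \<in> borel_measurable F" by (simp add: p_def)
  have pM [measurable]: "p \<in> borel_measurable M" by (simp add: p_def)
  have hM [measurable]: "h \<in> borel_measurable M" using measurable_from_subalg[OF sub h] .
  have u_int: "integrable M ?u" by (rule integrable_const_bound[of _ 1]) auto
  \<comment> \<open>With values of \<open>p\<close> in the unit interval, \<open>p * h * e\<close>
    is dominated by \<open>h * e\<close> and inherits its integrability.\<close>
  have p0: "AE w in M. 0 \<le> p w" unfolding p_def by (rule real_cond_exp_pos) auto
  have p1: "AE w in M. p w \<le> 1" unfolding p_def by (rule real_cond_exp_le_c[OF u_int]) auto
  have "(\<integral>w. U w * (h w * e w) \<partial>M) = (\<integral>w. ?u w * g (V w, X w) \<partial>M)"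
  proof (rule integral_cong_AE)
    show "AE w in M. U w * (h w * e w) = ?u w * g (V w, X w)"
      using U01 AE_space by eventually_elim (auto simp: ghe)
    have "(\<lambda>w. g (V w, X w)) \<in> borel_measurable M \<longleftrightarrow> (\<lambda>w. h w * e w) \<in> borel_measurable M"
      by (rule measurable_cong) (rule ghe)
    then have [measurable]: "(\<lambda>w. g (V w, X w)) \<in> borel_measurable M" by simp
    show "(\<lambda>w. ?u w * g (V w, X w)) \<in> borel_measurable M" by measurable
  qed simp
  also have "\<dots> = (\<integral>w. p w * g (V w, X w) \<partial>M)"
    unfolding p_def F_def by (rule cond_indep_integral[OF M X U V ci[unfolded F_def] g])
  also have "\<dots> = (\<integral>w. (p w * h w) * e w \<partial>M)"
    by (intro Bochner_Integration.integral_cong refl) (simp add: ghe mult.assoc)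
  also have "\<dots> = (\<integral>w. (p w * h w) * real_cond_exp M F e w \<partial>M)"
  proof (rule real_cond_exp_intg(2)[symmetric])
    show "integrable M (\<lambda>w. p w * h w * e w)"
    proof (rule Bochner_Integration.integrable_bound[OF int])
      show "AE w in M. norm (p w * h w * e w) \<le> norm (h w * e w)"
        using p0 p1 by eventually_elim (simp add: abs_mult mult.assoc mult_left_le_one_le)
    qed simp
  qed auto
  also have "\<dots> = (\<integral>w. 0 \<partial>M)"
    using e0 by (intro integral_cong_AE) (auto intro: borel_measurable_cond_exp2)
  finally show ?thesis by simp
qed

text \<open>Strictness of \<open>K < T\<close> avoids the question whether the infimum is attained:
  some admissible \<open>t\<close> lies below \<open>T\<close>.\<close>

lemma orlicz2_exp_le:
  assumes "orlicz_norm 2 M Z \<le> ereal K" "K < T"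
  shows "(\<integral>\<^sup>+ w. ennreal (exp ((Z w)\<^sup>2 / T\<^sup>2)) \<partial>M) \<le> 2"
proof -
  have "orlicz_norm 2 M Z < ereal T" using assms by (simp add: order_le_less_trans)
  then obtain t where t: "0 < t" "t < T" "(\<integral>\<^sup>+ w. ennreal (exp (\<bar>Z w\<bar> powr 2 / t powr 2)) \<partial>M) \<le> 2"
    unfolding orlicz_norm_def Inf_less_iff by auto
  have "(\<integral>\<^sup>+ w. ennreal (exp ((Z w)\<^sup>2 / T\<^sup>2)) \<partial>M) \<le> (\<integral>\<^sup>+ w. ennreal (exp (\<bar>Z w\<bar> powr 2 / t powr 2)) \<partial>M)"
    using t by (intro nn_integral_mono ennreal_leI) (auto intro!: divide_left_mono power_mono)
  then show ?thesis using t(3) by simp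
qed

text \<open>Two uses of the arithmetic-geometric mean inequality: the first bounds the product by
  half the sum of squares, the second bounds the resulting product of exponentials by an average of
  the two given moments.\<close>

lemma product_exp_le:
  fixes f g r :: "'a \<Rightarrow> real"
  assumes [measurable]: "f \<in> borel_measurable M" "g \<in> borel_measurable M" "r \<in> borel_measurable M"
    and r: "AE w in M. \<bar>r w\<bar> \<le> 1"
    and T: "0 < S" "0 < T"
    and f: "(\<integral>\<^sup>+ w. ennreal (exp ((f w)\<^sup>2 / S\<^sup>2)) \<partial>M) \<le> 2"
    and g: "(\<integral>\<^sup>+ w. ennreal (exp ((g w)\<^sup>2 / T\<^sup>2)) \<partial>M) \<le> 2"
  shows "(\<integral>\<^sup>+ w. ennreal (exp (\<bar>r w * f w * g w\<bar> / (S * T))) \<partial>M) \<le> 2"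
proof -
  let ?A = "\<lambda>w. exp ((f w)\<^sup>2 / S\<^sup>2)" and ?B = "\<lambda>w. exp ((g w)\<^sup>2 / T\<^sup>2)"
  have pt: "exp (\<bar>r * x * y\<bar> / (S * T)) \<le> 1 / 2 * exp (x\<^sup>2 / S\<^sup>2) + 1 / 2 * exp (y\<^sup>2 / T\<^sup>2)"
    if "\<bar>r\<bar> \<le> 1" for r x y
  proof -
    define a b where "a = \<bar>x\<bar> / S" and "b = \<bar>y\<bar> / T"
    have ab: "a\<^sup>2 = x\<^sup>2 / S\<^sup>2" "b\<^sup>2 = y\<^sup>2 / T\<^sup>2" by (auto simp: a_def b_def power_divide)
    have "\<bar>r * x * y\<bar> / (S * T) = \<bar>r\<bar> * (a * b)"
      by (simp add: a_def b_def abs_mult)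
    also have "\<dots> \<le> a * b" using that T by (intro mult_left_le_one_le) (auto simp: a_def b_def)
    also have "\<dots> \<le> a\<^sup>2 / 2 + b\<^sup>2 / 2" using sum_squares_bound[of a b] by simp
    finally have "exp (\<bar>r * x * y\<bar> / (S * T)) \<le> exp (a\<^sup>2 / 2 + b\<^sup>2 / 2)" by simp
    also have "\<dots> = exp (a\<^sup>2 / 2) * exp (b\<^sup>2 / 2)" by (rule exp_add)
    also have "\<dots> \<le> (exp (a\<^sup>2 / 2))\<^sup>2 / 2 + (exp (b\<^sup>2 / 2))\<^sup>2 / 2"
      using sum_squares_bound[of "exp (a\<^sup>2 / 2)" "exp (b\<^sup>2 / 2)"] by simp
    also have "\<dots> = 1 / 2 * exp (a\<^sup>2) + 1 / 2 * exp (b\<^sup>2)"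
      by (simp add: exp_double[symmetric])
    finally show ?thesis by (simp add: ab)
  qed
  have "(\<integral>\<^sup>+ w. ennreal (exp (\<bar>r w * f w * g w\<bar> / (S * T))) \<partial>M)
      \<le> (\<integral>\<^sup>+ w. ennreal (1 / 2) * ennreal (?A w) + ennreal (1 / 2) * ennreal (?B w) \<partial>M)"
  proof (rule nn_integral_mono_AE)
    show "AE w in M. ennreal (exp (\<bar>r w * f w * g w\<bar> / (S * T)))
        \<le> ennreal (1 / 2) * ennreal (?A w) + ennreal (1 / 2) * ennreal (?B w)"
      using r
    proof eventually_elim
      case (elim w)
      have "ennreal (exp (\<bar>r w * f w * g w\<bar> / (S * T))) \<le> ennreal (1 / 2 * ?A w + 1 / 2 * ?B w)"
        by (intro ennreal_leI pt elim)
      moreover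
      have "ennreal (c * x + c * y) = ennreal c * ennreal x + ennreal c * ennreal y"
        if "0 \<le> c" "0 \<le> x" "0 \<le> y" for c x y :: real
        using that by (simp add: ennreal_mult ennreal_plus)
      from this[of "1 / 2" "?A w" "?B w"]
      have "ennreal (1 / 2 * ?A w + 1 / 2 * ?B w)
          = ennreal (1 / 2) * ennreal (?A w) + ennreal (1 / 2) * ennreal (?B w)" by simp
      ultimately show ?case by (simp only:)
    qed
  qed
  also have "\<dots> = ennreal (1 / 2) * (\<integral>\<^sup>+ w. ennreal (?A w) \<partial>M) + ennreal (1 / 2) * (\<integral>\<^sup>+ w. ennreal (?B w) \<partial>M)"
    by (simp add: nn_integral_add nn_integral_cmult)
  also have "\<dots> \<le> ennreal (1 / 2) * 2 + ennreal (1 / 2) * 2"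
    using f g by (intro add_mono mult_left_mono) auto
  also have "ennreal (1 / 2) * 2 = 1" using ennreal_mult[of "1 / 2" 2] by simp
  also have "1 + 1 = (2 :: ennreal)" by simp
  finally show ?thesis .
qed

subsection \<open>Random design\<close>

lemma dinner_commute: "dinner d u v = dinner d v u"
  by (simp add: dinner_def mult.commute)

lemma dinner_scale: "dinner d u (\<lambda>j. c * v j) = c * dinner d u v"
  by (simp add: dinner_def sum_distrib_left mult_ac)

definition unit_vec :: "nat \<Rightarrow> nat \<Rightarrow> real" where
  "unit_vec k = (\<lambda>j. if j = k then 1 else 0)"

lemma dinner_unit_vec: "k < d \<Longrightarrow> dinner d u (unit_vec k) = u k"
  by (simp add: dinner_def unit_vec_def if_distrib cong: if_cong)

lemma unit_vec_sphere:
  assumes "k < d"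
  shows "norm2 d (unit_vec k) = 1" "supp d (unit_vec k) = {k}"
proof -
  have "(\<Sum>j<d. (unit_vec k j)\<^sup>2) = (\<Sum>j<d. if j = k then 1 else 0)"
    by (intro sum.cong) (auto simp: unit_vec_def)
  then show "norm2 d (unit_vec k) = 1" using assms by (simp add: norm2_def)
  show "supp d (unit_vec k) = {k}" using assms by (auto simp: supp_def unit_vec_def)
qed

locale design = prob_space P
  for P :: "(real \<times> real \<times> (nat \<Rightarrow> real)) measure" +
  fixes d :: nat
  assumes sets_P: "sets P = sets (obs_space d)"
    and sq_int: "\<And>j. j < d \<Longrightarrow> integrable P (\<lambda>w. (obsX w j)\<^sup>2)"
    and R01: "AE w in P. obsR w \<in> {0, 1}"
begin

lemma measurable_obsX [measurable]: "obsX \<in> measurable P (PiM {..<d} (\<lambda>_. borel))"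
  unfolding measurable_cong_sets[OF sets_P refl] obs_space_def obsX_def by measurable

lemma measurable_obsY [measurable]: "obsY \<in> borel_measurable P"
  unfolding measurable_cong_sets[OF sets_P refl] obs_space_def obsY_def by measurable

lemma measurable_obsR [measurable]: "obsR \<in> borel_measurable P"
  unfolding measurable_cong_sets[OF sets_P refl] obs_space_def obsR_def by measurable

lemma measurable_obsX_component: "j < d \<Longrightarrow> (\<lambda>w. obsX w j) \<in> borel_measurable P"
  by (rule measurable_compose[OF measurable_obsX measurable_component_singleton]) simp

lemma measurable_dinner [measurable]: "(\<lambda>w. dinner d (obsX w) u) \<in> borel_measurable P"
  unfolding dinner_def using measurable_obsX_component by (intro borel_measurable_sum) auto

lemma measurable_noise [measurable]: "noise d \<beta>0 \<in> borel_measurable P"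
  unfolding noise_def by measurable

lemma R_bound: "AE w in P. \<bar>obsR w\<bar> \<le> 1"
  using R01 by eventually_elim auto

lemma integrable_product:
  fixes f g :: "real \<times> real \<times> (nat \<Rightarrow> real) \<Rightarrow> real"
  assumes "integrable P (\<lambda>w. (f w)\<^sup>2)" "integrable P (\<lambda>w. (g w)\<^sup>2)"
    and [measurable]: "f \<in> borel_measurable P" "g \<in> borel_measurable P"
  shows "integrable P (\<lambda>w. f w * g w)"
proof (rule Bochner_Integration.integrable_bound[OF Bochner_Integration.integrable_add[OF assms(1,2)]])
  have "\<bar>x * y\<bar> \<le> x\<^sup>2 + y\<^sup>2" for x y :: real
    using sum_squares_bound[of x y] sum_squares_bound[of x "- y"] abs_ge_zero[of "x * y"]
    unfolding abs_le_iff by auto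
  then show "AE w in P. norm (f w * g w) \<le> norm ((f w)\<^sup>2 + (g w)\<^sup>2)" by simp
qed simp

lemma integrable_R_mult:
  assumes "integrable P f"
  shows "integrable P (\<lambda>w. obsR w * f w)"
proof (rule Bochner_Integration.integrable_bound[OF assms])
  show "AE w in P. norm (obsR w * f w) \<le> norm (f w)"
    using R_bound by eventually_elim (simp add: abs_mult mult_left_le_one_le)
qed (use assms in simp)

lemma integrable_XX: "i < d \<Longrightarrow> j < d \<Longrightarrow> integrable P (\<lambda>w. obsX w i * obsX w j)"
  by (intro integrable_product sq_int measurable_obsX_component)

lemma dinner_mult:
  "dinner d x a * dinner d x b = (\<Sum>i<d. \<Sum>j<d. a i * (x i * x j) * b j)"
  by (simp add: dinner_def sum_product mult_ac)

lemma integrable_dinner_mult: "integrable P (\<lambda>w. dinner d (obsX w) a * dinner d (obsX w) b)"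
  unfolding dinner_mult
  by (intro Bochner_Integration.integrable_sum integrable_mult_left integrable_mult_right integrable_XX) auto

lemma integrable_dinner_sq: "integrable P (\<lambda>w. (dinner d (obsX w) a)\<^sup>2)"
  using integrable_dinner_mult[of a a] by (simp add: power2_eq_square)

text \<open>A real \<open>Sup\<close> carries information only for bounded sets. By Cauchy-Schwarz
  the trace of the second-moment matrix is a bound.\<close>

lemma bdd_above_eig:
  "bdd_above ((\<lambda>u. \<integral>w. (dinner d (obsX w) u)\<^sup>2 \<partial>P) ` {u \<in> unit_sphere d. card (supp d u) \<le> s})"
proof (intro bdd_aboveI2[where M = "\<integral>w. (\<Sum>j<d. (obsX w j)\<^sup>2) \<partial>P"])
  fix u assume "u \<in> {u \<in> unit_sphere d. card (supp d u) \<le> s}"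
  then have u: "norm2 d u = 1" by (simp add: unit_sphere_def)
  show "(\<integral>w. (dinner d (obsX w) u)\<^sup>2 \<partial>P) \<le> (\<integral>w. (\<Sum>j<d. (obsX w j)\<^sup>2) \<partial>P)"
  proof (rule integral_mono[OF integrable_dinner_sq])
    show "integrable P (\<lambda>w. \<Sum>j<d. (obsX w j)\<^sup>2)"
      by (intro Bochner_Integration.integrable_sum sq_int) simp
    show "(dinner d (obsX w) u)\<^sup>2 \<le> (\<Sum>j<d. (obsX w j)\<^sup>2)" for w
      using dinner_le_norm2[of d "obsX w" u] u
      by (simp add: norm2_power2[symmetric] abs_le_square_iff[symmetric])
  qed
qed

lemma eig_upper:
  assumes "norm2 d u = 1" "card (supp d u) \<le> s"
  shows "(\<integral>w. (dinner d (obsX w) u)\<^sup>2 \<partial>P) \<le> sparse_max_eig P d s"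
  unfolding sparse_max_eig_def using assms
  by (intro cSUP_upper bdd_above_eig) (simp add: unit_sphere_def)

text \<open>Normalisation reduces the ball to the sphere. A vector of norm zero relies on
  \<open>nn\<close>, since the supremum may range over an empty set.\<close>

lemma eig_upper_sparse_ball:
  assumes u: "u \<in> sparse_ball d s" and nn: "0 \<le> sparse_max_eig P d s"
  shows "(\<integral>w. (dinner d (obsX w) u)\<^sup>2 \<partial>P) \<le> sparse_max_eig P d s"
proof (cases "norm2 d u = 0")
  case True
  then have "dinner d (obsX w) u = 0" for w
    using dinner_le_norm2[of d "obsX w" u] by simp
  then show ?thesis using nn by simp
next
  case False
  define c where "c = norm2 d u"
  have c: "0 < c" "c \<le> 1" using False u by (auto simp: c_def less_le sparse_ball_def)
  define v where "v = (\<lambda>j. 1 / c * u j)"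
  have "norm2 d v = 1" using c by (simp only: v_def norm2_scale) (simp add: c_def)
  moreover have "supp d v = supp d u" using c by (auto simp: v_def supp_def)
  ultimately have v: "(\<integral>w. (dinner d (obsX w) v)\<^sup>2 \<partial>P) \<le> sparse_max_eig P d s"
    using u by (intro eig_upper) (auto simp: sparse_ball_def)
  have "u = (\<lambda>j. c * v j)" using c by (simp add: v_def)
  then have "(\<integral>w. (dinner d (obsX w) u)\<^sup>2 \<partial>P) = c\<^sup>2 * (\<integral>w. (dinner d (obsX w) v)\<^sup>2 \<partial>P)"
    by (simp add: dinner_scale power_mult_distrib)
  also have "\<dots> \<le> (\<integral>w. (dinner d (obsX w) v)\<^sup>2 \<partial>P)"
    using c by (intro mult_left_le_one_le) (auto simp: power_le_one)
  finally show ?thesis using v by simp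
qed

text \<open>A coordinate vector with index in \<open>S\<close> is 1-sparse and lies in the cone. The
  comparison makes the sparse eigenvalue positive, so that it can serve as a scale.\<close>

lemma restricted_eig_le_sparse_max_eig:
  assumes k: "k \<in> S" "k < d" and s: "1 \<le> s"
    and re: "\<forall>v \<in> cone1 d S 3 \<inter> unit_sphere d. (\<integral>w. obsR w * (dinner d (obsX w) v)\<^sup>2 \<partial>P) \<ge> \<kappa>\<^sup>2"
  shows "\<kappa>\<^sup>2 \<le> sparse_max_eig P d s"
proof -
  let ?e = "unit_vec k"
  have "norm1 d (- S) ?e = 0"
    using k unfolding norm1_def by (intro sum.neutral) (auto simp: unit_vec_def)
  then have "?e \<in> cone1 d S 3 \<inter> unit_sphere d"
    using k by (simp add: cone1_def unit_sphere_def unit_vec_sphere norm1_def sum_nonneg)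
  then have "\<kappa>\<^sup>2 \<le> (\<integral>w. obsR w * (dinner d (obsX w) ?e)\<^sup>2 \<partial>P)" using re by blast
  also have "\<dots> \<le> (\<integral>w. (dinner d (obsX w) ?e)\<^sup>2 \<partial>P)"
  proof (rule integral_mono_AE[OF integrable_R_mult integrable_dinner_sq])
    show "AE w in P. obsR w * (dinner d (obsX w) ?e)\<^sup>2 \<le> (dinner d (obsX w) ?e)\<^sup>2"
      using R01 by eventually_elim auto
  qed (rule integrable_dinner_sq)
  also have "\<dots> \<le> sparse_max_eig P d s"
    using k s by (intro eig_upper) (simp_all add: unit_vec_sphere)
  finally show ?thesis .
qed

text \<open>The deterministic inequality needs nonnegative weights at every sample point considered;
  the exceptional null set is removed here at no cost in probability.\<close>

lemma whp_R_nonneg: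
  fixes n :: nat
  shows "whp (PiM {..<n} (\<lambda>_. P)) 1 (\<lambda>\<omega>. \<forall>i<n. 0 \<le> obsR (\<omega> i))"
proof -
  let ?Q = "PiM {..<n} (\<lambda>_. P)"
  interpret Q: prob_space ?Q by (rule prob_space_PiM) (rule prob_space_axioms)
  have "AE \<omega> in ?Q. 0 \<le> obsR (\<omega> i)" if "i \<in> {..<n}" for i
    using that R01 by (intro AE_PiM_component[where P = "\<lambda>w. 0 \<le> obsR w"])
      (auto intro: prob_space_axioms elim!: eventually_mono)
  then have "AE \<omega> in ?Q. \<forall>i\<in>{..<n}. 0 \<le> obsR (\<omega> i)" by (intro AE_finite_allI finite_lessThan)
  then obtain B where B: "{\<omega> \<in> space ?Q. \<not> (\<forall>i\<in>{..<n}. 0 \<le> obsR (\<omega> i))} \<subseteq> B"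
      "emeasure ?Q B = 0" "B \<in> sets ?Q"
    by (rule AE_E)
  have "measure ?Q B = 0" using B(2) by (simp add: measure_def)
  then have "measure ?Q (space ?Q - B) = 1" using Q.prob_compl[OF B(3)] by simp
  then show ?thesis
    unfolding whp_def using B(1,3) by (intro bexI[of _ "space ?Q - B"]) auto
qed

end

section \<open>Sub-Gaussian designs: restricted eigenvalues and noise on the sample\<close>

locale sub_gaussian_design = design +
  fixes K :: real
  assumes K_pos: "0 < K"
    and sub_gaussian: "\<And>u. orlicz_norm 2 P (\<lambda>w. dinner d u (obsX w))
           \<le> ereal (K * sqrt (\<integral>w. (dinner d u (obsX w))\<^sup>2 \<partial>P))"
begin

text \<open>One scale serves the whole sparse ball, as a union bound requires. The factor 2 supplies
  the strict room above the Orlicz norm.\<close>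

lemma exp_dinner_sparse:
  assumes a: "a \<in> sparse_ball d s" and pos: "0 < sparse_max_eig P d s"
  shows "(\<integral>\<^sup>+w. ennreal (exp ((dinner d (obsX w) a)\<^sup>2 / (2 * K * sqrt (sparse_max_eig P d s))\<^sup>2)) \<partial>P) \<le> 2"
proof (rule orlicz2_exp_le)
  show "orlicz_norm 2 P (\<lambda>w. dinner d (obsX w) a) \<le> ereal (K * sqrt (sparse_max_eig P d s))"
  proof (rule order_trans)
    show "orlicz_norm 2 P (\<lambda>w. dinner d (obsX w) a)
        \<le> ereal (K * sqrt (\<integral>w. (dinner d (obsX w) a)\<^sup>2 \<partial>P))"
      using sub_gaussian[of a] by (simp add: dinner_commute[of d a])
    show "ereal (K * sqrt (\<integral>w. (dinner d (obsX w) a)\<^sup>2 \<partial>P)) \<le> ereal (K * sqrt (sparse_max_eig P d s))"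
      using eig_upper_sparse_ball[OF a] pos K_pos by simp
  qed
  show "K * sqrt (sparse_max_eig P d s) < 2 * K * sqrt (sparse_max_eig P d s)"
    using K_pos pos by simp
qed

lemma restricted_eig_sample:
  fixes n :: nat
  assumes S: "S \<subseteq> {..<d}" and s: "s = card S" "1 \<le> s" and n: "1 \<le> n"
    and \<delta>: "0 < \<delta>" "\<delta> < 1" and \<kappa>: "0 < \<kappa>"
    and re: "\<forall>v \<in> cone1 d S 3 \<inter> unit_sphere d. (\<integral>w. obsR w * (dinner d (obsX w) v)\<^sup>2 \<partial>P) \<ge> \<kappa>\<^sup>2"
    and rate: "sqrt (real s * ln (exp 1 * real d / real s) / real n) + sqrt (ln (1 / \<delta>) / real n)
       < min (\<kappa>\<^sup>2 / (32000 * K\<^sup>2 * sparse_max_eig P d s)) 1"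
  shows "whp (PiM {..<n} (\<lambda>_. P)) (1 - \<delta> / 2) (\<lambda>\<omega>. \<forall>v \<in> cone1 d S 3.
    \<kappa>\<^sup>2 / 2 * (norm2 d v)\<^sup>2 \<le> 1 / real n * (\<Sum>i<n. obsR (\<omega> i) * (dinner d (obsX (\<omega> i)) v)\<^sup>2))"
proof -
  define \<phi> where "\<phi> = sparse_max_eig P d s"
  have sd: "s \<le> d" using card_mono[OF _ S] s by simp
  obtain k where k: "k \<in> S" using s by fastforce
  have \<phi>: "\<kappa>\<^sup>2 \<le> \<phi>"
    unfolding \<phi>_def using k S s by (intro restricted_eig_le_sparse_max_eig[OF k _ _ re]) auto
  then have \<phi>0: "0 < \<phi>" using \<kappa> by (meson less_le_trans zero_less_power)
  define T where "T = 2 * K * sqrt \<phi>"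
  have T: "0 < T" "T * T = 4 * K\<^sup>2 * \<phi>" using K_pos \<phi>0 by (auto simp: T_def power2_eq_square)
  let ?l = "real s * ln (exp 1 * real d / real s)" and ?m = "ln (1 / \<delta>)"
  define r where "r = sqrt (?l / real n) + sqrt (?m / real n)"
  have "1 \<le> ln (exp 1 * real d / real s)" using s sd by (simp add: ln_div ln_mult)
  then have l: "1 \<le> ?l" using s mult_mono[of 1 "real s" 1 "ln (exp 1 * real d / real s)"] by simp
  have m: "0 \<le> ?m" using \<delta> by simp
  have r: "0 \<le> r" "r \<le> 1" "r * (32000 * K\<^sup>2 * \<phi>) \<le> \<kappa>\<^sup>2"
    using rate l m \<phi>0 K_pos by (auto simp: r_def \<phi>_def[symmetric] pos_less_divide_eq)
  \<comment> \<open>Squaring the sum of the roots adds only a nonnegative cross term, so the single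
    parameter \<open>r\<close> pays for both the net and the confidence level.\<close>
  have r2: "?l + ?m \<le> real n * r\<^sup>2"
  proof -
    have "?l / real n + ?m / real n \<le> r\<^sup>2"
      using l m by (simp add: r_def power2_sum)
    then show ?thesis using n by (simp add: field_simps)
  qed
  obtain N where N: "finite N" "N \<subseteq> sparse_ball d s" "real (card N) \<le> exp (18 * ?l)"
    "\<And>a. a \<in> sparse_ball d s \<Longrightarrow>
       \<exists>b\<in>N. supp d b \<subseteq> supp d a \<and> norm2 d (\<lambda>j. a j - b j) \<le> 1 / 4"
    using sparse_ball_net[OF s(2) sd] by blast
  define F where "F = (\<lambda>p w. obsR w * dinner d (obsX w) (fst p) * dinner d (obsX w) (snd p))"
  let ?Q = "PiM {..<n} (\<lambda>_. P)"
  \<comment> \<open>The exponent 38 is 36 plus 2: there are at most \<open>exp (36 * ?l)\<close>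
    pairs of net points, and the surplus \<open>exp (- 2 * ?l)\<close>, at most 1/4, turns the
    factor 2 of the two-sided bound into 1/2.\<close>
  have "whp ?Q (1 - \<delta> / 2) (\<lambda>\<omega>. \<forall>p\<in>N \<times> N.
    \<bar>1 / real n * (\<Sum>i<n. F p (\<omega> i)) - (\<integral>x. F p x \<partial>P)\<bar> < 2 * (38 + 2) * (T * T) * r)"
  proof (rule bernstein_iid_finite)
    show "(\<integral>\<^sup>+x. ennreal (exp (\<bar>F p x\<bar> / (T * T))) \<partial>P) \<le> 2" if "p \<in> N \<times> N" for p
      unfolding F_def using that N(2) \<phi>0 T(1) R_bound exp_dinner_sparse[of _ s]
      by (intro product_exp_le) (auto simp: T_def \<phi>_def)
    have "2 * real (card (N \<times> N)) * exp (- 38 * (real n * r\<^sup>2))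
        \<le> 2 * (exp (18 * ?l) * exp (18 * ?l)) * exp (- 38 * (?l + ?m))"
      using N(3) r2 by (simp only: card_cartesian_product of_nat_mult)
        (intro mult_mono, auto)
    also have "\<dots> = 2 * exp (- 2 * ?l) * exp (- 38 * ?m)"
      by (simp add: exp_add[symmetric] algebra_simps)
    also have "\<dots> \<le> 2 * (1 / 4) * exp (- ?m)"
    proof (intro mult_mono)
      have "4 \<le> exp (1::real) * exp 1"
        using mult_mono[of 2 "exp 1::real" 2 "exp 1"] exp_ge_add_one_self[of 1] by simp
      then have "4 \<le> exp (2 * ?l)" using l by (smt (verit) exp_add exp_le_cancel_iff)
      then show "exp (- 2 * ?l) \<le> 1 / 4" by (simp add: exp_minus field_simps)
    qed (use m in auto)
    also have "\<dots> = \<delta> / 2" using \<delta> by (simp add: ln_div)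
    finally show "2 * real (card (N \<times> N)) * exp (- 38 * (real n * r\<^sup>2)) \<le> \<delta> / 2" .
  qed (use N(1) T(1) n r(1,2) prob_space_axioms in \<open>auto simp: F_def\<close>)
  then show ?thesis
  proof (rule whp_mono)
    fix \<omega> assume \<omega>: "\<forall>p\<in>N \<times> N.
      \<bar>1 / real n * (\<Sum>i<n. F p (\<omega> i)) - (\<integral>x. F p x \<partial>P)\<bar> < 2 * (38 + 2) * (T * T) * r"
    define A where "A = (\<lambda>i j. 1 / real n * (\<Sum>k<n. obsR (\<omega> k) * (obsX (\<omega> k) i * obsX (\<omega> k) j))
      - (\<integral>w. obsR w * (obsX w i * obsX w j) \<partial>P))"
    have bil: "bilin d A a b = 1 / real n * (\<Sum>i<n. F (a, b) (\<omega> i)) - (\<integral>x. F (a, b) x \<partial>P)" for a b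
    proof -
      have Feq: "F (a, b) w = (\<Sum>i<d. \<Sum>j<d. a i * (obsR w * (obsX w i * obsX w j)) * b j)" for w
        unfolding F_def fst_conv snd_conv mult.assoc dinner_mult by (simp add: sum_distrib_left mult_ac)
      have "(\<integral>x. F (a, b) x \<partial>P) = (\<Sum>i<d. \<Sum>j<d. a i * (\<integral>w. obsR w * (obsX w i * obsX w j) \<partial>P) * b j)"
      proof -
        have int: "integrable P (\<lambda>w. a i * (obsR w * (obsX w i * obsX w j)) * b j)" if "i < d" "j < d" for i j
          using integrable_R_mult[OF integrable_XX[OF that]] by simp
        have "(\<integral>x. F (a, b) x \<partial>P) = (\<Sum>i<d. \<integral>w. (\<Sum>j<d. a i * (obsR w * (obsX w i * obsX w j)) * b j) \<partial>P)"
          unfolding Feq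
          by (rule Bochner_Integration.integral_sum) (intro Bochner_Integration.integrable_sum int; simp)
        also have "\<dots> = (\<Sum>i<d. \<Sum>j<d. \<integral>w. a i * (obsR w * (obsX w i * obsX w j)) * b j \<partial>P)"
          by (intro sum.cong refl Bochner_Integration.integral_sum int; simp)
        finally show ?thesis by simp
      qed
      moreover have "1 / real n * (\<Sum>k<n. F (a, b) (\<omega> k))
          = (\<Sum>i<d. \<Sum>j<d. a i * (1 / real n * (\<Sum>k<n. obsR (\<omega> k) * (obsX (\<omega> k) i * obsX (\<omega> k) j))) * b j)"
        unfolding Feq by (subst sum.swap, subst sum.swap[of _ _ "{..<n}"])
          (simp add: sum_distrib_left sum_distrib_right mult_ac)
      ultimately show ?thesis
        by (simp add: bilin_def A_def left_diff_distrib right_diff_distrib sum_subtractf)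
    qed
    have sparse: "\<bar>bilin d A a b\<bar> \<le> 2 * (80 * (T * T) * r)"
      if "a \<in> sparse_ball d s" "b \<in> sparse_ball d s" for a b
      by (rule abs_bilin_le_net[OF N(4) N(2) _ that]) (use \<omega> in \<open>auto simp: bil less_imp_le\<close>)
    have unit: "\<kappa>\<^sup>2 / 2 \<le> 1 / real n * (\<Sum>i<n. obsR (\<omega> i) * (dinner d (obsX (\<omega> i)) v)\<^sup>2)"
      if v: "v \<in> cone1 d S 3" "norm2 d v = 1" for v
    proof -
      \<comment> \<open>On the cone the 1-norm is at most \<open>4 * sqrt s\<close> times the
        2-norm, which fixes \<open>c\<close> as 4.\<close>
      have "\<bar>bilin d A v v\<bar> \<le> (1 + 4)\<^sup>2 * (2 * (80 * (T * T) * r))"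
        using cone1_norm1_le[OF v(1) S] v(2) s by (intro bilin_le_sparse[OF s(2) sd sparse]) auto
      also have "\<dots> = r * (32000 * K\<^sup>2 * \<phi>) / 2" unfolding T(2) by simp
      finally have "\<bar>bilin d A v v\<bar> \<le> \<kappa>\<^sup>2 / 2" using r(3) by linarith
      moreover have "\<kappa>\<^sup>2 \<le> (\<integral>w. obsR w * (dinner d (obsX w) v)\<^sup>2 \<partial>P)"
        using re v by (auto simp: unit_sphere_def)
      moreover have "F (v, v) = (\<lambda>w. obsR w * (dinner d (obsX w) v)\<^sup>2)"
        by (simp add: F_def power2_eq_square mult.assoc)
      ultimately show ?thesis
        unfolding bil by (simp only:)
    qed
    show "\<forall>v \<in> cone1 d S 3. \<kappa>\<^sup>2 / 2 * (norm2 d v)\<^sup>2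
      \<le> 1 / real n * (\<Sum>i<n. obsR (\<omega> i) * (dinner d (obsX (\<omega> i)) v)\<^sup>2)"
    proof
      fix v assume v: "v \<in> cone1 d S 3"
      define c where "c = norm2 d v"
      show "\<kappa>\<^sup>2 / 2 * (norm2 d v)\<^sup>2
        \<le> 1 / real n * (\<Sum>i<n. obsR (\<omega> i) * (dinner d (obsX (\<omega> i)) v)\<^sup>2)"
      proof (cases "c = 0")
        case True
        then have "dinner d (obsX (\<omega> i)) v = 0" for i
          using dinner_le_norm2[of d "obsX (\<omega> i)" v] by (simp add: c_def)
        then show ?thesis using True by (simp add: c_def)
      next
        case False
        then have c: "0 < c" by (simp add: c_def less_le)
        define u where "u = (\<lambda>j. 1 / c * v j)"
        have "norm2 d u = 1" using c by (simp only: u_def norm2_scale) (simp add: c_def)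
        moreover have "norm1 d S' u = norm1 d S' v / c" for S'
          using c by (simp add: norm1_def u_def abs_mult sum_divide_distrib)
        then have "u \<in> cone1 d S 3" using v c by (simp add: cone1_def divide_right_mono)
        ultimately have "c\<^sup>2 * (\<kappa>\<^sup>2 / 2) \<le> c\<^sup>2 * (1 / real n * (\<Sum>i<n. obsR (\<omega> i) * (dinner d (obsX (\<omega> i)) u)\<^sup>2))"
          by (intro mult_left_mono unit) auto
        moreover have "dinner d x v = c * dinner d x u" for x
          unfolding u_def dinner_scale using c by simp
        ultimately show ?thesis
          by (simp add: c_def[symmetric] power_mult_distrib sum_distrib_left mult_ac)
      qed
    qed
  qed simp
qed

lemma noise_orthogonal:
  assumes ci: "cond_indep_given P (sigmaX d P) obsR obsY"
    and int: "integrable P (\<lambda>w. (noise d \<beta>0 w)\<^sup>2)"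
    and e0: "AE w in P. real_cond_exp P (sigmaX d P) (noise d \<beta>0) w = 0"
    and j: "j < d"
  shows "(\<integral>w. obsR w * obsX w j * noise d \<beta>0 w \<partial>P) = 0"
proof -
  let ?N = "PiM {..<d} (\<lambda>_. borel :: real measure)"
  have comp: "(\<lambda>x. x i) \<in> borel_measurable ?N" if "i < d" for i
    by (rule measurable_component_singleton) (use that in simp)
  have [measurable]: "(\<lambda>x. dinner d x \<beta>0) \<in> borel_measurable ?N"
    unfolding dinner_def using comp by (intro borel_measurable_sum borel_measurable_times) auto
  have [measurable]: "(\<lambda>x. x j) \<in> borel_measurable ?N" using comp[OF j] .
  have XF: "obsX \<in> measurable (sigmaX d P) ?N"
    unfolding sigmaX_def using measurable_space[OF measurable_obsX]
    by (intro measurable_vimage_algebra1) auto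
  have "(\<integral>w. obsR w * (obsX w j * noise d \<beta>0 w) \<partial>P) = 0"
  proof (rule cond_indep_integral_zero[where V = obsY and X = obsX and N = ?N
        and g = "\<lambda>z. snd z j * (fst z - dinner d (snd z) \<beta>0)"])
    show "(\<lambda>z. snd z j * (fst z - dinner d (snd z) \<beta>0)) \<in> borel_measurable (borel \<Otimes>\<^sub>M ?N)"
      by (intro borel_measurable_times borel_measurable_diff
          measurable_compose[OF measurable_snd] measurable_fst) auto
    show "(\<lambda>w. obsX w j) \<in> borel_measurable (vimage_algebra (space P) obsX ?N)"
      using measurable_compose[OF XF comp[OF j]] by (simp add: sigmaX_def)
    show "integrable P (\<lambda>w. obsX w j * noise d \<beta>0 w)"
      using j by (intro integrable_product sq_int int measurable_obsX_component measurable_noise)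
    show "cond_indep_given P (vimage_algebra (space P) obsX ?N) obsR obsY"
      using ci by (simp add: sigmaX_def)
    show "AE w in P. real_cond_exp P (vimage_algebra (space P) obsX ?N) (noise d \<beta>0) w = 0"
      using e0 by (simp add: sigmaX_def)
    show "AE w in P. obsR w \<in> {0, 1}" by (rule R01)
  qed (auto intro: prob_space_axioms simp: noise_def[of d \<beta>0])
  then show ?thesis by (simp add: mult.assoc)
qed

text \<open>A union bound over the \<open>d\<close> centred sub-exponential coordinates; the bound
  on \<open>ln (real d / \<delta>) / real n\<close> puts \<open>r\<close> in the range of
  Bernstein's inequality. The resulting level is the penalty prescribed in part (b).\<close>

lemma noise_sup_bound:
  fixes n :: nat
  assumes ci: "cond_indep_given P (sigmaX d P) obsR obsY"
    and int: "integrable P (\<lambda>w. (noise d \<beta>0 w)\<^sup>2)"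
    and e0: "AE w in P. real_cond_exp P (sigmaX d P) (noise d \<beta>0) w = 0"
    and sg: "orlicz_norm 2 P (noise d \<beta>0) \<le> ereal (K' * \<sigma>)" "0 < K'" "0 < \<sigma>"
    and \<phi>: "0 < sparse_max_eig P d 1"
    and d: "2 \<le> d" and n: "1 \<le> n" and \<delta>: "0 < \<delta>" "\<delta> < 1"
    and r: "ln (real d / \<delta>) / real n \<le> 1"
  shows "whp (PiM {..<n} (\<lambda>_. P)) (1 - \<delta> / 2) (\<lambda>\<omega>.
    4 / real n * norminf d (\<lambda>j. \<Sum>i<n. obsR (\<omega> i) * obsX (\<omega> i) j * noise d \<beta>0 (\<omega> i))
      \<le> 160 * K * K' * \<sigma> * sqrt (sparse_max_eig P d 1 * ln (real d / \<delta>) / real n))"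
proof -
  define \<phi> where "\<phi> = sparse_max_eig P d 1"
  define r where "r = sqrt (ln (real d / \<delta>) / real n)"
  define F where "F = (\<lambda>j w. obsR w * obsX w j * noise d \<beta>0 w)"
  let ?Q = "PiM {..<n} (\<lambda>_. P)" and ?S = "2 * K * sqrt \<phi>" and ?T = "2 * K' * \<sigma>"
  have pos: "0 < ?S" "0 < ?T" using K_pos \<phi> sg by (auto simp: \<phi>_def)
  have "real d / \<delta> \<ge> 1" using d \<delta> by (simp add: field_simps)
  then have ln0: "0 \<le> ln (real d / \<delta>)" by simp
  then have r01: "0 \<le> r" "r \<le> 1" "real n * r\<^sup>2 = ln (real d / \<delta>)"
    using r n by (auto simp: r_def)
  \<comment> \<open>Exponent 3 makes the total failure probability
    \<open>2 * d * (\<delta> / d) ^ 3\<close>, at most \<open>\<delta> / 2\<close> for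
    \<open>d\<close> at least 2.\<close>
  have "whp ?Q (1 - \<delta> / 2) (\<lambda>\<omega>. \<forall>j\<in>{..<d}.
    \<bar>1 / real n * (\<Sum>i<n. F j (\<omega> i)) - (\<integral>x. F j x \<partial>P)\<bar> < 2 * (3 + 2) * (?S * ?T) * r)"
  proof (rule bernstein_iid_finite)
    fix j assume "j \<in> {..<d}"
    then have j: "j < d" by simp
    have "unit_vec j \<in> sparse_ball d 1" using j by (simp add: sparse_ball_def unit_vec_sphere)
    from exp_dinner_sparse[OF this \<phi>] have
      "(\<integral>\<^sup>+w. ennreal (exp ((obsX w j)\<^sup>2 / ?S\<^sup>2)) \<partial>P) \<le> 2"
      using j by (simp add: dinner_unit_vec \<phi>_def)
    moreover have "(\<integral>\<^sup>+w. ennreal (exp ((noise d \<beta>0 w)\<^sup>2 / ?T\<^sup>2)) \<partial>P) \<le> 2"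
      using sg by (intro orlicz2_exp_le[OF sg(1)]) simp
    ultimately show "(\<integral>\<^sup>+x. ennreal (exp (\<bar>F j x\<bar> / (?S * ?T))) \<partial>P) \<le> 2"
      unfolding F_def using pos R_bound measurable_obsX_component[OF j]
      by (intro product_exp_le) auto
    show "F j \<in> borel_measurable P"
      unfolding F_def using measurable_obsX_component[OF j] by measurable
  next
    have "exp (- ln (real d / \<delta>)) = \<delta> / real d"
      using d \<delta> by (simp add: exp_minus)
    then have "exp (- 3 * (real n * r\<^sup>2)) = (\<delta> / real d) ^ 3"
      unfolding r01(3) using exp_of_nat_mult[of 3 "- ln (real d / \<delta>)"] by simp
    moreover have "2 * real d * (\<delta> / real d) ^ 3 = \<delta> * (2 * \<delta>\<^sup>2 / (real d)\<^sup>2)"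
      using d by (simp add: power3_eq_cube power2_eq_square field_simps)
    moreover have "2 * \<delta>\<^sup>2 / (real d)\<^sup>2 \<le> 1 / 2"
    proof -
      have "\<delta>\<^sup>2 \<le> 1" using \<delta> by (intro power_le_one) auto
      moreover have "2\<^sup>2 \<le> (real d)\<^sup>2" using d by (intro power_mono) auto
      ultimately show ?thesis using d by (simp add: field_simps)
    qed
    ultimately show "2 * real (card {..<d}) * exp (- 3 * (real n * r\<^sup>2)) \<le> \<delta> / 2"
      using mult_left_mono[of "2 * \<delta>\<^sup>2 / (real d)\<^sup>2" "1 / 2" \<delta>] \<delta> by simp
  qed (use mult_pos_pos[OF pos] n r01 prob_space_axioms in auto)
  then show ?thesis
  proof (rule whp_mono)
    fix \<omega> assume \<omega>: "\<forall>j\<in>{..<d}.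
      \<bar>1 / real n * (\<Sum>i<n. F j (\<omega> i)) - (\<integral>x. F j x \<partial>P)\<bar> < 2 * (3 + 2) * (?S * ?T) * r"
    let ?g = "\<lambda>j. \<Sum>i<n. F j (\<omega> i)"
    have "norminf d ?g \<in> (\<lambda>j. \<bar>?g j\<bar>) ` {..<d}"
      unfolding norminf_def using d by (intro Max_in) (auto simp: lessThan_empty_iff)
    then obtain j where j: "j < d" "norminf d ?g = \<bar>?g j\<bar>" by auto
    have "\<bar>1 / real n * ?g j\<bar> \<le> 2 * (3 + 2) * (?S * ?T) * r"
    proof -
      have "(\<integral>x. F j x \<partial>P) = 0" unfolding F_def by (rule noise_orthogonal[OF ci int e0 j(1)])
      then show ?thesis using \<omega>[rule_format, of j] j(1) by simp
    qed
    then have "4 / real n * norminf d ?g \<le> 4 * (2 * (3 + 2) * (?S * ?T) * r)"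
      unfolding j(2) by (simp add: abs_mult)
    \<comment> \<open>160 is 4 from the noise condition, 10 from Bernstein with exponent 3, and 4
      from the two doubled Orlicz scales.\<close>
    also have "\<dots> = 160 * K * K' * \<sigma> * (sqrt \<phi> * r)" by simp
    also have "sqrt \<phi> * r = sqrt (\<phi> * ln (real d / \<delta>) / real n)"
      by (simp add: r_def real_sqrt_mult[symmetric])
    finally show "4 / real n * norminf d (\<lambda>j. \<Sum>i<n. obsR (\<omega> i) * obsX (\<omega> i) j * noise d \<beta>0 (\<omega> i))
      \<le> 160 * K * K' * \<sigma> * sqrt (sparse_max_eig P d 1 * ln (real d / \<delta>) / real n)"
      by (simp only: F_def \<phi>_def)
  qed simp
qed

end

section \<open>Combination of the deterministic and the probabilistic bounds\<close>

text \<open>The form is at least \<open>\<kappa>\<^sup>2 / 2\<close> times the squared norm of the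
  error and at most \<open>3 / 2 * lam * sqrt s\<close> times the norm; cancelling one norm leaves
  the constant 3.\<close>

lemma lasso_error_bound:
  assumes min: "lasso_min d n lam \<omega> \<beta>"
    and S: "S = supp d \<beta>0" "S \<noteq> {}" and lam: "0 < lam" and \<kappa>: "0 < \<kappa>"
    and R: "\<And>i. i < n \<Longrightarrow> 0 \<le> obsR (\<omega> i)"
    and noise: "4 / real n * norminf d (\<lambda>j. \<Sum>i<n. obsR (\<omega> i) * obsX (\<omega> i) j * noise d \<beta>0 (\<omega> i)) \<le> lam"
    and re: "\<forall>v \<in> cone1 d S 3. \<kappa>\<^sup>2 / 2 * (norm2 d v)\<^sup>2
      \<le> 1 / real n * (\<Sum>i<n. obsR (\<omega> i) * (dinner d (obsX (\<omega> i)) v)\<^sup>2)"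
  shows "norm2 d (\<lambda>j. \<beta> j - \<beta>0 j) \<le> 3 * sqrt (real (card S)) * lam / \<kappa>\<^sup>2"
proof -
  let ?h = "\<lambda>j. \<beta> j - \<beta>0 j" and ?s = "sqrt (real (card S))"
  have Sd: "S \<subseteq> {..<d}" and d: "0 < d" using S by (auto simp: supp_def)
  note basic = lasso_basic[OF min d lam R noise, folded S(1)]
  define x where "x = norm2 d ?h"
  have "\<kappa>\<^sup>2 / 2 * x\<^sup>2 \<le> 3 / 2 * lam * norm1 d S ?h"
    using re basic unfolding x_def by (blast intro: order_trans)
  also have "\<dots> \<le> 3 / 2 * lam * (?s * x)"
    using lam norm1_le_sqrt_card[OF Sd, of ?h] unfolding x_def by (intro mult_left_mono) auto
  finally have *: "x * (\<kappa>\<^sup>2 * x) \<le> x * (3 * ?s * lam)" by (simp add: power2_eq_square mult_ac)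
  have "x \<le> 3 * ?s * lam / \<kappa>\<^sup>2"
  proof (cases "x = 0")
    case True then show ?thesis using lam by simp
  next
    case False
    then have "0 < x" by (simp add: x_def less_le)
    then have "\<kappa>\<^sup>2 * x \<le> 3 * ?s * lam" using * by simp
    then show ?thesis using \<kappa> by (simp add: field_simps)
  qed
  then show ?thesis by (simp add: x_def)
qed

text \<open>The difference of the two sides is \<open>(s - 1) * (ln d - ln s) + (s - ln s)\<close>,
  a sum of nonnegative terms. It lets the sparse rate control the \<open>ln d\<close> of the noise
  bound.\<close>

lemma ln_le_sparse_rate:
  assumes "1 \<le> s" "s \<le> d"
  shows "ln (real d) \<le> real s * ln (exp 1 * real d / real s)"
proof -
  have "(real s - 1) * ln (real s) \<le> (real s - 1) * ln (real d)"
    using assms by (intro mult_left_mono) auto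
  moreover have "ln (real s) \<le> real s" using assms ln_le_minus_one[of "real s"] by simp
  moreover have eq: "ln (exp 1 * real d / real s) = 1 + ln (real d) - ln (real s)"
    using assms by (simp add: ln_div ln_mult)
  ultimately show ?thesis unfolding eq by (simp add: algebra_simps)
qed

lemma complete_case_lasso:
  fixes P :: "(real \<times> real \<times> (nat \<Rightarrow> real)) measure" and d n :: nat and \<beta>0 :: "nat \<Rightarrow> real"
    and \<sigma> \<kappa> \<delta> lam KX K\<epsilon> :: real
  defines "S \<equiv> supp d \<beta>0" and "s \<equiv> card (supp d \<beta>0)" and "\<phi> \<equiv> sparse_max_eig P d"
    and "Q \<equiv> PiM {..<n} (\<lambda>_. P)"
    and "Z \<equiv> \<lambda>\<omega>. 4 / real n * norminf d (\<lambda>j. \<Sum>i<n. obsR (\<omega> i) * obsX (\<omega> i) j * noise d \<beta>0 (\<omega> i))"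
    and "A2 \<equiv> 160 * KX * K\<epsilon>"
  assumes K: "0 < KX" "0 < K\<epsilon>"
    and P: "prob_space P" "sets P = sets (obs_space d)"
    and sq: "\<forall>j<d. integrable P (\<lambda>w. (obsX w j)\<^sup>2)"
    and R01: "AE w in P. obsR w \<in> {0, 1}"
    and \<epsilon>: "integrable P (\<lambda>w. (noise d \<beta>0 w)\<^sup>2)"
    and \<sigma>: "0 \<le> \<sigma>"
    and e0: "AE w in P. real_cond_exp P (sigmaX d P) (noise d \<beta>0) w = 0"
    and ci: "cond_indep_given P (sigmaX d P) obsR obsY"
    and sg: "\<forall>u. orlicz_norm 2 P (\<lambda>w. dinner d u (obsX w))
           \<le> ereal (KX * sqrt (\<integral>w. (dinner d u (obsX w))\<^sup>2 \<partial>P))"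
    and \<kappa>: "0 < \<kappa>"
    and re: "\<forall>v \<in> cone1 d S 3 \<inter> unit_sphere d. (\<integral>w. obsR w * (dinner d (obsX w) v)\<^sup>2 \<partial>P) \<ge> \<kappa>\<^sup>2"
    and lam: "0 < lam" and s1: "1 \<le> s" and n: "1 \<le> n" and \<delta>: "0 < \<delta>" "\<delta> < 1"
    and rate: "sqrt (real s * ln (exp 1 * real d / real s) / real n) + sqrt (ln (1 / \<delta>) / real n)
       < min (\<kappa>\<^sup>2 / (32000 * KX\<^sup>2 * \<phi> s)) 1"
  shows "whp Q (1 - \<delta>) (\<lambda>\<omega>. Z \<omega> < lam \<longrightarrow> (\<forall>\<beta>. lasso_min d n lam \<omega> \<beta> \<longrightarrow>
           norm2 d (\<lambda>j. \<beta> j - \<beta>0 j) \<le> 3 * sqrt (real s) * lam / \<kappa>\<^sup>2))"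
    and "2 \<le> d \<Longrightarrow> orlicz_norm 2 P (noise d \<beta>0) \<le> ereal (K\<epsilon> * \<sigma>) \<Longrightarrow>
         lam = A2 * \<sigma> * sqrt (\<phi> 1 * ln (real d / \<delta>) / real n) \<Longrightarrow>
         whp Q (1 - \<delta>) (\<lambda>\<omega>. \<forall>\<beta>. lasso_min d n lam \<omega> \<beta> \<longrightarrow>
           norm2 d (\<lambda>j. \<beta> j - \<beta>0 j)
             \<le> 3 * A2 * \<sigma> / \<kappa>\<^sup>2 * sqrt (\<phi> 1 * real s * ln (real d / \<delta>) / real n))"
proof -
  interpret sub_gaussian_design P d KX
    using P sq R01 K(1) sg by (simp add: sub_gaussian_design_def design_def design_axioms_def sub_gaussian_design_axioms_def)
  have Q: "prob_space Q" unfolding Q_def by (rule prob_space_PiM) (rule P)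
  have S: "S \<subseteq> {..<d}" "s = card S" by (auto simp: S_def s_def supp_def)
  have S_ne: "S \<noteq> {}" using s1 S(2) by force
  have sd: "s \<le> d" using card_mono[OF _ S(1)] S(2) by simp
  let ?RE = "\<lambda>\<omega>. \<forall>v \<in> cone1 d S 3.
    \<kappa>\<^sup>2 / 2 * (norm2 d v)\<^sup>2 \<le> 1 / real n * (\<Sum>i<n. obsR (\<omega> i) * (dinner d (obsX (\<omega> i)) v)\<^sup>2)"
  have RE: "whp Q (1 - \<delta> / 2) ?RE"
    unfolding Q_def using rate
    by (intro restricted_eig_sample[OF S(1,2) s1 n \<delta> \<kappa> re]) (simp add: \<phi>_def)
  have R: "whp Q (1 - 0) (\<lambda>\<omega>. \<forall>i<n. 0 \<le> obsR (\<omega> i))"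
    unfolding Q_def using whp_R_nonneg by simp
  note RRE = whp_conj[OF Q R RE]
  \<comment> \<open>On the good event the bound holds for all minimisers at once, so no measurable
    selection of an estimator enters.\<close>
  have det: "norm2 d (\<lambda>j. \<beta> j - \<beta>0 j) \<le> 3 * sqrt (real s) * lam / \<kappa>\<^sup>2"
    if "(\<forall>i<n. 0 \<le> obsR (\<omega> i)) \<and> ?RE \<omega>" "Z \<omega> \<le> lam" "lasso_min d n lam \<omega> \<beta>" for \<omega> \<beta>
    unfolding S(2) using that
    by (intro lasso_error_bound[OF that(3) S_def[THEN meta_eq_to_obj_eq] S_ne lam \<kappa>]) (auto simp: Z_def)
  show "whp Q (1 - \<delta>) (\<lambda>\<omega>. Z \<omega> < lam \<longrightarrow> (\<forall>\<beta>. lasso_min d n lam \<omega> \<beta> \<longrightarrow>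
           norm2 d (\<lambda>j. \<beta> j - \<beta>0 j) \<le> 3 * sqrt (real s) * lam / \<kappa>\<^sup>2))"
    using RRE by (rule whp_mono) (use \<delta> det in \<open>auto simp del: real_sqrt_le_iff\<close>)
  assume d: "2 \<le> d" and sge: "orlicz_norm 2 P (noise d \<beta>0) \<le> ereal (K\<epsilon> * \<sigma>)"
    and lam_eq: "lam = A2 * \<sigma> * sqrt (\<phi> 1 * ln (real d / \<delta>) / real n)"
  \<comment> \<open>A positive penalty of the prescribed form excludes \<open>\<sigma> = 0\<close>,
    where the Orlicz scale of the noise would degenerate.\<close>
  have \<sigma>0: "0 < \<sigma>" using lam \<sigma> unfolding lam_eq by (cases "\<sigma> = 0") auto
  obtain k where k: "k \<in> S" using S_ne by blast
  have "\<kappa>\<^sup>2 \<le> sparse_max_eig P d 1"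
    using k S by (intro restricted_eig_le_sparse_max_eig[OF k _ _ re]) auto
  then have \<phi>: "0 < sparse_max_eig P d 1" using \<kappa> by (meson less_le_trans zero_less_power)
  \<comment> \<open>Two roots with sum below 1 have squares with sum at most 1, and these squares
    dominate the \<open>ln d\<close> and the \<open>ln (1 / \<delta>)\<close> contributions.\<close>
  have "ln (real d / \<delta>) / real n \<le> 1"
  proof -
    let ?a = "real s * ln (exp 1 * real d / real s) / real n" and ?b = "ln (1 / \<delta>) / real n"
    have ln_d: "ln (real d) \<le> real s * ln (exp 1 * real d / real s)"
      by (rule ln_le_sparse_rate[OF s1 sd])
    have "0 \<le> ln (real d)" using d by simp
    then have a: "0 \<le> ?a" and b: "0 \<le> ?b" using ln_d \<delta> by auto
    have "?a + ?b \<le> (sqrt ?a + sqrt ?b)\<^sup>2" using a b by (simp add: power2_sum)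
    also have "\<dots> \<le> 1" using rate a b by (intro power_le_one) auto
    finally have "?a + ?b \<le> 1" .
    moreover have "ln (real d / \<delta>) / real n \<le> ?a + ?b"
      unfolding add_divide_distrib[symmetric] using ln_d \<delta> d by (intro divide_right_mono) (auto simp: ln_div)
    ultimately show ?thesis by linarith
  qed
  then have noise: "whp Q (1 - \<delta> / 2) (\<lambda>\<omega>. Z \<omega> \<le> lam)"
    unfolding Q_def Z_def lam_eq A2_def \<phi>_def
    by (rule noise_sup_bound[OF ci \<epsilon> e0 sge K(2) \<sigma>0 \<phi> d n \<delta>])
  have bound: "3 * sqrt (real s) * lam / \<kappa>\<^sup>2
      = 3 * A2 * \<sigma> / \<kappa>\<^sup>2 * sqrt (\<phi> 1 * real s * ln (real d / \<delta>) / real n)"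
    unfolding lam_eq by (simp add: real_sqrt_mult real_sqrt_divide mult_ac)
  show "whp Q (1 - \<delta>) (\<lambda>\<omega>. \<forall>\<beta>. lasso_min d n lam \<omega> \<beta> \<longrightarrow>
           norm2 d (\<lambda>j. \<beta> j - \<beta>0 j)
             \<le> 3 * A2 * \<sigma> / \<kappa>\<^sup>2 * sqrt (\<phi> 1 * real s * ln (real d / \<delta>) / real n))"
    unfolding bound[symmetric] using whp_conj[OF Q RRE noise]
    by (rule whp_mono) (use det in auto)
qed

text \<open>The constants \<open>KX\<close> and \<open>K\<epsilon>\<close> implicit in the
  sub-Gaussian hypotheses are quantified first; "absolute" means that the remaining constants depend
  on these two alone.\<close>

theorem theorem3:
  shows "\<forall>KX > 0. \<forall>K\<epsilon> > 0. \<exists>A1 > 0. \<exists>A2 > 0. \<exists>Ca > 0. \<exists>Cb > 0.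
   \<forall>(d::nat) (n::nat) (P :: (real \<times> real \<times> (nat \<Rightarrow> real)) measure) (\<beta>0 :: nat \<Rightarrow> real)
     (\<sigma>::real) (\<kappa>::real) (\<delta>::real) (lam::real).
   let S = supp d \<beta>0; s = card S; \<epsilon> = noise d \<beta>0;
       \<Omega> = PiM {..<n} (\<lambda>_. P);
       \<phi> = sparse_max_eig P d;
       \<epsilon>i = (\<lambda>\<omega> i. noise d \<beta>0 (\<omega> i))
   in
   ( prob_space P \<and> sets P = sets (obs_space d)
   \<and> (\<forall>j<d. integrable P (\<lambda>w. (obsX w j)\<^sup>2))
   \<and> (AE w in P. obsR w \<in> {0, 1})
   \<and> integrable P (\<lambda>w. (\<epsilon> w)\<^sup>2)
   \<and> \<sigma> \<ge> 0
   \<and> (AE w in P. real_cond_exp P (sigmaX d P) \<epsilon> w = 0)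
   \<and> (AE w in P. real_cond_exp P (sigmaX d P) (\<lambda>w. (\<epsilon> w)\<^sup>2) w = \<sigma>\<^sup>2)
   \<and> cond_indep_given P (sigmaX d P) obsR obsY
   \<and> (\<forall>u. orlicz_norm 2 P (\<lambda>w. dinner d u (obsX w))
           \<le> ereal (KX * sqrt (\<integral>w. (dinner d u (obsX w))\<^sup>2 \<partial>P)))
   \<and> \<kappa> > 0
   \<and> (\<forall>v \<in> cone1 d S 3 \<inter> unit_sphere d. (\<integral>w. obsR w * (dinner d (obsX w) v)\<^sup>2 \<partial>P) \<ge> \<kappa>\<^sup>2)
   \<and> lam > 0
   \<and> s \<ge> 1 \<and> n \<ge> 1
   \<and> 0 < \<delta> \<and> \<delta> < 1
   \<and> sqrt (real s * ln (exp 1 * real d / real s) / real n) + sqrt (ln (1 / \<delta>) / real n)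
       < min (\<kappa>\<^sup>2 / (A1 * \<phi> s)) 1 )
   \<longrightarrow>
   ( (d \<ge> s + 2 \<longrightarrow>
       whp \<Omega> (1 - \<delta>) (\<lambda>\<omega>.
         (lam > 4 / real n * norminf d (\<lambda>j. \<Sum>i<n. obsR (\<omega> i) * obsX (\<omega> i) j * \<epsilon>i \<omega> i)
          \<and> 4 / real n * norminf d (\<lambda>j. \<Sum>i<n. obsR (\<omega> i) * obsX (\<omega> i) j * \<epsilon>i \<omega> i) > 0)
         \<longrightarrow> (\<forall>\<beta>. lasso_min d n lam \<omega> \<beta> \<longrightarrow>
                norm2 d (\<lambda>j. \<beta> j - \<beta>0 j) \<le> Ca * sqrt (real s) * lam / \<kappa>\<^sup>2)))
   \<and> ((d \<ge> s + 2
        \<and> orlicz_norm 2 P \<epsilon> \<le> ereal (K\<epsilon> * \<sigma>)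
        \<and> lam = A2 * \<sigma> * sqrt (\<phi> 1 * ln (real d / \<delta>) / real n)) \<longrightarrow>
       whp \<Omega> (1 - \<delta>) (\<lambda>\<omega>. \<forall>\<beta>. lasso_min d n lam \<omega> \<beta> \<longrightarrow>
                norm2 d (\<lambda>j. \<beta> j - \<beta>0 j)
                  \<le> Cb * \<sigma> / \<kappa>\<^sup>2 * sqrt (\<phi> 1 * real s * ln (real d / \<delta>) / real n))) )"
proof (intro allI impI, goal_cases)
  case (1 KX K\<epsilon>)
  show ?case
    unfolding Let_def
  proof (rule exI[of _ "32000 * KX\<^sup>2"], rule conjI, goal_cases)
    case 2
    show ?case
    proof (rule exI[of _ "160 * KX * K\<epsilon>"], rule conjI, goal_cases)
      case 2
      show ?case
      proof (rule exI[of _ 3], rule conjI, simp, rule exI[of _ "3 * (160 * KX * K\<epsilon>)"], rule conjI,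
          goal_cases)
        case 2
        show ?case
        proof (intro allI impI, elim conjE, goal_cases)
          case (1 d n P \<beta>0 \<sigma> \<kappa> \<delta> lam)
          note main = complete_case_lasso[OF \<open>0 < KX\<close> \<open>0 < K\<epsilon>\<close> 1(1-7,9-18)]
          show ?case
            using whp_mono[OF main(1) order_refl] main(2) by auto
        qed
      qed (use 1 in simp)
    qed (use 1 in simp)
  qed (use 1 in simp)
qed

end
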